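(* If there is a polynomial-time $\alpha(m,n)$-approximation algorithm for the maximum-spanning-tree interdiction problem on instances with $m$ edges and $n$ nodes, then there is a polynomial-time $2\alpha(m+n-1,n)$-approximation algorithm for the minimization densest-$k$-subgraph problem on instances with $m$ edges and $n$ nodes.
   Context: Maximum-spanning-tree interdiction: input is a multigraph $G=(V,E)$, weights $w_e\ge 0$, interdiction costs $c_e\ge0$, and budget $B$; the goal is to choose $R\subseteq E$ with $\sum_{e\in R}c_e\le B$ minimizing the maximum $w$-weight of a spanning tree of $(V,E\setminus R)$. An $\alpha$-approximation algorithm for it returns a feasible $R$ whose objective is at most $\alpha$ times the optimum. Minimization densest-$k$-subgraph (min-DkS): given a graph $H=(N,F)$ and an integer $k$, find a minimum-size set $S\subseteq N$ such that at least $k$ edges of $F$ have both endpoints in $S$; an $\alpha$-approximation returns a feasible $S$ of size at most $\alpha$ times the optimum. *)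

theory Defs
  imports Complex_Main "HOL-Computational_Algebra.Polynomial"
begin

section \<open>Model of computation\<close>

text \<open>
  Polynomial time is measured for WHILE programs over binary trees (the WHILE language of
  N. D. Jones, \<^emph>\<open>Computability and Complexity from a Programming Perspective\<close>).
  Evaluating an expression costs one unit plus the size of the resulting value, for each of
  its subexpressions, so values are never shared for free and the size of the store is bounded
  by the input size plus the running time. With this cost, WHILE programs and Turing machines
  simulate each other with polynomial overhead.
\<close>

datatype data = Leaf | Node data data

datatype expr =
    Var nat
  | Const data
  | Cons expr expr
  | Hd expr
  | Tl expr
  | Eq expr expr

datatype com =
    Skip
  | Assign nat expr
  | Seq com com
  | Cond expr com com
  | While expr com

type_synonym store = "nat \<Rightarrow> data"

fun hd_data :: "data \<Rightarrow> data" where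
  "hd_data Leaf = Leaf"
| "hd_data (Node a b) = a"

fun tl_data :: "data \<Rightarrow> data" where
  "tl_data Leaf = Leaf"
| "tl_data (Node a b) = b"

definition enc_bool :: "bool \<Rightarrow> data" where
  "enc_bool b = (if b then Node Leaf Leaf else Leaf)"

fun eval_expr :: "expr \<Rightarrow> store \<Rightarrow> data" where
  "eval_expr (Var x) s = s x"
| "eval_expr (Const d) s = d"
| "eval_expr (Cons e f) s = Node (eval_expr e s) (eval_expr f s)"
| "eval_expr (Hd e) s = hd_data (eval_expr e s)"
| "eval_expr (Tl e) s = tl_data (eval_expr e s)"
| "eval_expr (Eq e f) s = enc_bool (eval_expr e s = eval_expr f s)"

fun time_expr :: "expr \<Rightarrow> store \<Rightarrow> nat" where
  "time_expr (Var x) s = 1 + size (s x)"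
| "time_expr (Const d) s = 1 + size d"
| "time_expr (Cons e f) s =
     time_expr e s + time_expr f s + 1 + size (eval_expr (Cons e f) s)"
| "time_expr (Hd e) s = time_expr e s + 1 + size (eval_expr (Hd e) s)"
| "time_expr (Tl e) s = time_expr e s + 1 + size (eval_expr (Tl e) s)"
| "time_expr (Eq e f) s =
     time_expr e s + time_expr f s + 1 + size (eval_expr (Eq e f) s)"

text \<open>\<open>exec c s t s'\<close>: started in store \<open>s\<close>, the program \<open>c\<close> halts after time \<open>t\<close> in store \<open>s'\<close>.
  A test succeeds iff its value is not \<^const>\<open>Leaf\<close>.\<close>

inductive exec :: "com \<Rightarrow> store \<Rightarrow> nat \<Rightarrow> store \<Rightarrow> bool" where
  Skip: "exec Skip s 1 s"
| Assign: "exec (Assign x e) s (time_expr e s) (s(x := eval_expr e s))"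
| Seq: "exec c1 s1 t1 s2 \<Longrightarrow> exec c2 s2 t2 s3 \<Longrightarrow> exec (Seq c1 c2) s1 (t1 + t2) s3"
| CondTrue: "eval_expr e s \<noteq> Leaf \<Longrightarrow> exec c1 s t s' \<Longrightarrow>
    exec (Cond e c1 c2) s (time_expr e s + t) s'"
| CondFalse: "eval_expr e s = Leaf \<Longrightarrow> exec c2 s t s' \<Longrightarrow>
    exec (Cond e c1 c2) s (time_expr e s + t) s'"
| WhileFalse: "eval_expr e s = Leaf \<Longrightarrow> exec (While e c) s (time_expr e s) s"
| WhileTrue: "eval_expr e s1 \<noteq> Leaf \<Longrightarrow> exec c s1 t1 s2 \<Longrightarrow> exec (While e c) s2 t2 s3 \<Longrightarrow>
    exec (While e c) s1 (time_expr e s1 + t1 + t2) s3"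

text \<open>Variable 0 holds the input on start and the output on termination.\<close>

definition computes_in_time :: "com \<Rightarrow> data \<Rightarrow> nat \<Rightarrow> data \<Rightarrow> bool" where
  "computes_in_time c x t y \<longleftrightarrow> (\<exists>s. exec c ((\<lambda>_. Leaf)(0 := x)) t s \<and> s 0 = y)"

lemma exec_deterministic:
  "exec c s t s' \<Longrightarrow> exec c s u s'' \<Longrightarrow> t = u \<and> s' = s''"
proof (induction arbitrary: u s'' rule: exec.induct)
  case (Seq c1 s1 t1 s2 c2 t2 s3)
  from Seq.prems show ?case by cases (use Seq.IH in blast)
next
  case (WhileTrue e s1 c t1 s2 t2 s3)
  from WhileTrue.prems WhileTrue.hyps(1) show ?case by cases (use WhileTrue.IH in blast)+
qed (erule exec.cases; force)+


section \<open>Encodings\<close>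

fun enc_list :: "('a \<Rightarrow> data) \<Rightarrow> 'a list \<Rightarrow> data" where
  "enc_list f [] = Leaf"
| "enc_list f (x # xs) = Node (f x) (enc_list f xs)"

definition enc_pair :: "('a \<Rightarrow> data) \<Rightarrow> ('b \<Rightarrow> data) \<Rightarrow> 'a \<times> 'b \<Rightarrow> data" where
  "enc_pair f g = (\<lambda>(a, b). Node (f a) (g b))"

text \<open>Numbers are written in binary, least significant bit first.\<close>

fun enc_nat :: "nat \<Rightarrow> data" where
  "enc_nat n = (if n = 0 then Leaf else Node (enc_bool (odd n)) (enc_nat (n div 2)))"

declare enc_nat.simps [simp del]

text \<open>Only used for nonnegative rationals; \<^const>\<open>quotient_of\<close> returns the reduced fraction.\<close>

definition enc_rat :: "rat \<Rightarrow> data" where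
  "enc_rat q = enc_pair (\<lambda>a. enc_nat (nat a)) (\<lambda>b. enc_nat (nat b)) (quotient_of q)"

text \<open>A subset of the range of a list is written as its characteristic vector along the list.\<close>

definition enc_subset :: "'a list \<Rightarrow> 'a set \<Rightarrow> data" where
  "enc_subset xs A = enc_list enc_bool (map (\<lambda>x. x \<in> A) xs)"


section \<open>Minimization problems and approximation algorithms\<close>

record ('i, 's) min_problem =
  instances :: "'i set"
  feasible :: "'i \<Rightarrow> 's set"
  objective :: "'i \<Rightarrow> 's \<Rightarrow> real"
  enc_instance :: "'i \<Rightarrow> data"
  enc_solution :: "'i \<Rightarrow> 's \<Rightarrow> data"

text \<open>In both problems below every instance has finitely many, and at least one, feasible
  solutions, so that the minimum is attained.\<close>

definition optimum :: "('i, 's) min_problem \<Rightarrow> 'i \<Rightarrow> real" where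
  "optimum P I = Min (objective P I ` feasible P I)"

definition poly_time_approx ::
  "('i, 's) min_problem \<Rightarrow> ('i \<Rightarrow> real) \<Rightarrow> com \<Rightarrow> bool" where
  "poly_time_approx P ratio A \<longleftrightarrow>
     (\<exists>p :: nat poly. \<forall>I \<in> instances P. \<exists>t. \<exists>X \<in> feasible P I.
        computes_in_time A (enc_instance P I) t (enc_solution P I X) \<and>
        t \<le> poly p (size (enc_instance P I)) \<and>
        objective P I X \<le> ratio I * optimum P I)"


section \<open>Spanning trees of multigraphs\<close>

text \<open>A multigraph is given by a vertex set, a set of edge identifiers (here: positions in an
  edge list) and a map from edge identifiers to their sets of endpoints.\<close>

definition walk :: "(nat \<Rightarrow> nat set) \<Rightarrow> nat set \<Rightarrow> nat list \<Rightarrow> nat list \<Rightarrow> bool" where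
  "walk ends T xs p \<longleftrightarrow> length xs = Suc (length p) \<and>
     (\<forall>i < length p. p ! i \<in> T \<and> ends (p ! i) = {xs ! i, xs ! Suc i})"

definition connected_graph :: "nat set \<Rightarrow> (nat \<Rightarrow> nat set) \<Rightarrow> nat set \<Rightarrow> bool" where
  "connected_graph V ends T \<longleftrightarrow>
     (\<forall>u \<in> V. \<forall>v \<in> V. \<exists>xs p. walk ends T xs p \<and> hd xs = u \<and> last xs = v)"

definition has_cycle :: "(nat \<Rightarrow> nat set) \<Rightarrow> nat set \<Rightarrow> bool" where
  "has_cycle ends T \<longleftrightarrow>
     (\<exists>xs p. walk ends T xs p \<and> p \<noteq> [] \<and> hd xs = last xs \<and> distinct p \<and> distinct (tl xs))"

definition spanning_tree :: "nat set \<Rightarrow> (nat \<Rightarrow> nat set) \<Rightarrow> nat set \<Rightarrow> nat set \<Rightarrow> bool" where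
  "spanning_tree V ends E T \<longleftrightarrow>
     T \<subseteq> E \<and> connected_graph V ends T \<and> \<not> has_cycle ends T"


section \<open>Maximum-spanning-tree interdiction\<close>

text \<open>Nodes are listed explicitly; an edge is a tuple (endpoint, endpoint, weight, interdiction
  cost), and the edges of the multigraph are the positions in the list of these tuples.\<close>

record mst_instance =
  mst_nodes :: "nat list"
  mst_edges :: "(nat \<times> nat \<times> rat \<times> rat) list"
  budget :: rat

definition edge_ends :: "mst_instance \<Rightarrow> nat \<Rightarrow> nat set" where
  "edge_ends I i = (case mst_edges I ! i of (u, v, w, c) \<Rightarrow> {u, v})"

definition edge_weight :: "mst_instance \<Rightarrow> nat \<Rightarrow> rat" where
  "edge_weight I i = (case mst_edges I ! i of (u, v, w, c) \<Rightarrow> w)"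

definition edge_cost :: "mst_instance \<Rightarrow> nat \<Rightarrow> rat" where
  "edge_cost I i = (case mst_edges I ! i of (u, v, w, c) \<Rightarrow> c)"

definition edge_ids :: "mst_instance \<Rightarrow> nat set" where
  "edge_ids I = {..<length (mst_edges I)}"

definition remaining_trees :: "mst_instance \<Rightarrow> nat set \<Rightarrow> nat set set" where
  "remaining_trees I R = {T. spanning_tree (set (mst_nodes I)) (edge_ends I) (edge_ids I - R) T}"

definition interdiction_sets :: "mst_instance \<Rightarrow> nat set set" where
  "interdiction_sets I = {R. R \<subseteq> edge_ids I \<and> (\<Sum>i\<in>R. edge_cost I i) \<le> budget I}"

definition max_tree_weight :: "mst_instance \<Rightarrow> nat set \<Rightarrow> rat" where
  "max_tree_weight I R = Max ((\<lambda>T. \<Sum>i\<in>T. edge_weight I i) ` remaining_trees I R)"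

text \<open>The last condition says that the objective is defined for every set within the budget,
  i.e. that the budget does not suffice to disconnect the graph.\<close>

definition mst_instances :: "mst_instance set" where
  "mst_instances = {I.
     mst_nodes I \<noteq> [] \<and> distinct (mst_nodes I) \<and>
     (\<forall>(u, v, w, c) \<in> set (mst_edges I).
        u \<in> set (mst_nodes I) \<and> v \<in> set (mst_nodes I) \<and> u \<noteq> v \<and> 0 \<le> w \<and> 0 \<le> c) \<and>
     0 \<le> budget I \<and>
     (\<forall>R \<in> interdiction_sets I. remaining_trees I R \<noteq> {})}"

definition enc_mst_instance :: "mst_instance \<Rightarrow> data" where
  "enc_mst_instance I =
     Node (enc_list enc_nat (mst_nodes I))
       (Node (enc_list (enc_pair enc_nat (enc_pair enc_nat (enc_pair enc_rat enc_rat)))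
                (mst_edges I))
          (enc_rat (budget I)))"

definition mst_interdiction :: "(mst_instance, nat set) min_problem" where
  "mst_interdiction = \<lparr>
     instances = mst_instances,
     feasible = interdiction_sets,
     objective = (\<lambda>I R. real_of_rat (max_tree_weight I R)),
     enc_instance = enc_mst_instance,
     enc_solution = (\<lambda>I R. enc_subset [0..<length (mst_edges I)] R)\<rparr>"


section \<open>Minimization densest-\<open>k\<close>-subgraph\<close>

record dks_instance =
  dks_nodes :: "nat list"
  dks_edges :: "(nat \<times> nat) list"
  dks_k :: nat

definition dks_edge_set :: "dks_instance \<Rightarrow> nat set set" where
  "dks_edge_set H = (\<lambda>(u, v). {u, v}) ` set (dks_edges H)"

text \<open>Simple graphs, each edge being listed once in one of its two orientations. A feasible set
  exists iff \<open>k\<close> does not exceed the number of edges.\<close>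

definition dks_instances :: "dks_instance set" where
  "dks_instances = {H.
     dks_nodes H \<noteq> [] \<and> distinct (dks_nodes H) \<and>
     (\<forall>(u, v) \<in> set (dks_edges H). u \<in> set (dks_nodes H) \<and> v \<in> set (dks_nodes H) \<and> u \<noteq> v) \<and>
     distinct (map (\<lambda>(u, v). {u, v}) (dks_edges H)) \<and>
     dks_k H \<le> length (dks_edges H)}"

definition dks_feasible :: "dks_instance \<Rightarrow> nat set set" where
  "dks_feasible H =
     {S. S \<subseteq> set (dks_nodes H) \<and> dks_k H \<le> card {e \<in> dks_edge_set H. e \<subseteq> S}}"

definition enc_dks_instance :: "dks_instance \<Rightarrow> data" where
  "enc_dks_instance H =
     Node (enc_list enc_nat (dks_nodes H))
       (Node (enc_list (enc_pair enc_nat enc_nat) (dks_edges H)) (enc_nat (dks_k H)))"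

definition min_dks :: "(dks_instance, nat set) min_problem" where
  "min_dks = \<lparr>
     instances = dks_instances,
     feasible = dks_feasible,
     objective = (\<lambda>H S. real (card S)),
     enc_instance = enc_dks_instance,
     enc_solution = (\<lambda>H S. enc_subset (dks_nodes H) S)\<rparr>"

end

theory Submission
  imports Defs
begin

text \<open>
  Give the \<open>m\<close> edges of \<open>H\<close> weight 1 and cost 1, add a star of weight-0 edges that are too expensive
  to be removed, and set the budget to \<open>m - k\<close>. An interdiction set is then a set of at most
  \<open>m - k\<close> edges of \<open>H\<close>, and the objective is the rank of the remaining edges of \<open>H\<close>, of which there are
  at least \<open>k\<close>. If these touch exactly the nodes in \<open>S\<close>, their rank is at least \<open>|S| / 2\<close>, since every
  node of \<open>S\<close> meets an edge of \<open>H\<close> in some maximum spanning tree; and it is at most \<open>|S|\<close>, since a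
  forest has no more edges than nodes. The gap between the two bounds is the factor 2.
  Where \<open>\<alpha>\<close> is negative, both optima are 0.
\<close>

section \<open>Spanning trees\<close>

text \<open>An interdiction instance has to stay connected under every affordable removal. The star
  ensures this at the price of \<open>n - 1\<close> further edges, the origin of
  \<open>m + n - 1\<close>. Star edges may be parallel to edges of \<open>H\<close>, so the target
  must be a multigraph.

  Most of the length is due to the running time. The given interdiction algorithm is a black box,
  known only to work from stores in which every register except 0 is \<open>Leaf\<close>. The
  registers of the reduction are therefore placed above all of its registers, and its run is carried
  over to the actual store because the two stores agree on the registers that it mentions. The time
  bounds are deliberately coarse: let \<open>M\<close>, quadratic in the input size, bound the
  values that the reduction stores; a test or an assignment then costs a constant times
  \<open>M + 1\<close>, and a loop over a list makes at most \<open>M\<close> rounds. Incrementing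
  is the only arithmetic, on counters no larger than the length of an input list, so bounds linear
  in the value of a number, instead of in its number of bits, are good enough.\<close>

definition adj :: "(nat \<Rightarrow> nat set) \<Rightarrow> nat set \<Rightarrow> nat rel" where
  "adj ends T = {(x, y). \<exists>i\<in>T. ends i = {x, y}}"

lemma adj_mono: "A \<subseteq> B \<Longrightarrow> adj ends A \<subseteq> adj ends B"
  by (auto simp: adj_def)

lemma sym_adj: "sym (adj ends T)"
  by (auto simp: adj_def sym_def insert_commute)

lemma adj_rtrancl_sym: "(x, y) \<in> (adj ends T)\<^sup>* \<Longrightarrow> (y, x) \<in> (adj ends T)\<^sup>*"
  by (meson sym_adj sym_rtrancl symD)

lemma walk_singleton: "walk ends T [x] []"
  by (simp add: walk_def)

lemma walk_Cons:
  "xs \<noteq> [] \<Longrightarrow> walk ends T (x # xs) (i # p) \<longleftrightarrow>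
     i \<in> T \<and> ends i = {x, hd xs} \<and> walk ends T xs p"
  by (cases xs) (auto simp: walk_def All_less_Suc2)

lemma walk_drop:
  "walk ends T xs p \<Longrightarrow> n \<le> length p \<Longrightarrow> walk ends T (drop n xs) (drop n p)"
  by (auto simp: walk_def)

lemma walk_subset: "walk ends T xs p \<Longrightarrow> set p \<subseteq> U \<Longrightarrow> walk ends U xs p"
  by (auto simp: walk_def)

lemma walk_edges: "walk ends T xs p \<Longrightarrow> set p \<subseteq> T"
  by (auto simp: walk_def in_set_conv_nth)

lemma walk_imp_rtrancl: "walk ends T xs p \<Longrightarrow> (hd xs, last xs) \<in> (adj ends T)\<^sup>*"
proof (induction p arbitrary: xs)
  case Nil
  then show ?case by (cases xs) (auto simp: walk_def)
next
  case (Cons i p)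
  then obtain x ys where xs: "xs = x # ys" "ys \<noteq> []"
    by (auto simp: walk_def length_Suc_conv)
  with Cons.prems have *: "i \<in> T" "ends i = {x, hd ys}" "walk ends T ys p"
    by (simp_all add: walk_Cons)
  from * have "(x, hd ys) \<in> adj ends T" by (auto simp: adj_def)
  with Cons.IH[OF *(3)] show ?case
    using xs by (simp add: converse_rtrancl_into_rtrancl)
qed

lemma rtrancl_imp_simple_walk:
  assumes "(x, y) \<in> (adj ends T)\<^sup>*"
  shows "\<exists>xs p. walk ends T xs p \<and> hd xs = x \<and> last xs = y \<and> distinct xs"
  using assms
proof (induction rule: converse_rtrancl_induct)
  case base
  have "walk ends T [y] [] \<and> hd [y] = y \<and> last [y] = y \<and> distinct [y]"
    by (simp add: walk_singleton)
  then show ?case by blast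
next
  case (step x z)
  then obtain zs p where zs: "walk ends T zs p" "hd zs = z" "last zs = y" "distinct zs" by blast
  have ne: "zs \<noteq> []" using zs(1) by (auto simp: walk_def)
  show ?case
  proof (cases "x \<in> set zs")
    case True
    \<comment> \<open>The walk from \<open>z\<close> already visits \<open>x\<close>, so it is cut
      back to that visit instead of being extended.\<close>
    then obtain as bs where split: "zs = as @ x # bs" by (meson split_list)
    have "walk ends T (drop (length as) zs) (drop (length as) p)"
    proof (rule walk_drop[OF zs(1)])
      show "length as \<le> length p" using zs(1) split by (simp add: walk_def)
    qed
    then have "walk ends T (x # bs) (drop (length as) p) \<and> hd (x # bs) = x
        \<and> last (x # bs) = y \<and> distinct (x # bs)"
      using split zs by simp
    then show ?thesis by blast
  next
    case False
    from step.hyps(1) obtain i where "i \<in> T" "ends i = {x, z}" by (auto simp: adj_def)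
    then have "walk ends T (x # zs) (i # p) \<and> hd (x # zs) = x
        \<and> last (x # zs) = y \<and> distinct (x # zs)"
      using zs ne False by (simp add: walk_Cons)
    then show ?thesis by blast
  qed
qed

text \<open>An edge at two positions would give two equal pairs of consecutive vertices. With
  distinct vertices the positions then agree, or each is the successor of the other.\<close>

lemma simple_walk_distinct_edges:
  assumes "walk ends T xs p" "distinct xs"
  shows "distinct p"
  unfolding distinct_conv_nth
proof (intro allI impI notI)
  fix i j assume ij: "i < length p" "j < length p" "i \<noteq> j" "p ! i = p ! j"
  have l: "length xs = Suc (length p)" using assms(1) by (simp add: walk_def)
  from assms(1) ij have "{xs ! i, xs ! Suc i} = {xs ! j, xs ! Suc j}"
    unfolding walk_def by metis
  then have "(i = j \<and> Suc i = Suc j) \<or> (i = Suc j \<and> Suc i = j)"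
    using ij(1,2) assms(2) l by (simp add: doubleton_eq_iff nth_eq_iff_index_eq)
  with ij(3) show False by auto
qed

section \<open>Connectivity and cycles in terms of reachability\<close>

lemma connected_graph_iff:
  "connected_graph V ends T \<longleftrightarrow> (\<forall>u\<in>V. \<forall>v\<in>V. (u, v) \<in> (adj ends T)\<^sup>*)"
proof -
  have "(\<exists>xs p. walk ends T xs p \<and> hd xs = u \<and> last xs = v) \<longleftrightarrow> (u, v) \<in> (adj ends T)\<^sup>*" for u v
    by (metis walk_imp_rtrancl rtrancl_imp_simple_walk)
  then show ?thesis unfolding connected_graph_def by simp
qed

text \<open>A simple detour around \<open>i\<close> avoids \<open>i\<close> and has distinct edges,
  so \<open>i\<close> closes it to a cycle. Loops are included: for \<open>u = v\<close> the detour
  is the empty walk.\<close>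

lemma acyclic_edge_is_bridge:
  assumes "\<not> has_cycle ends T" "i \<in> T" "ends i = {u, v}"
  shows "(u, v) \<notin> (adj ends (T - {i}))\<^sup>*"
proof
  assume "(u, v) \<in> (adj ends (T - {i}))\<^sup>*"
  then obtain xs p where w: "walk ends (T - {i}) xs p" "hd xs = u" "last xs = v" "distinct xs"
    using rtrancl_imp_simple_walk by blast
  have p: "distinct p" "i \<notin> set p" "set p \<subseteq> T" and ne: "xs \<noteq> []"
    using simple_walk_distinct_edges[OF w(1,4)] walk_edges[OF w(1)] w(1)
    by (auto simp: walk_def)
  have "walk ends T (v # xs) (i # p)"
    using walk_subset[OF w(1) p(3)] assms(2,3) w(2) ne by (simp add: walk_Cons insert_commute)
  with p w ne have "has_cycle ends T"
    unfolding has_cycle_def by (intro exI[of _ "v # xs"] exI[of _ "i # p"]) simp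
  with assms(1) show False ..
qed

text \<open>The common core of the deletion and exchange arguments: connectivity survives if every
  lost edge is bridged by a path.\<close>

lemma rtrancl_adj_replace_edges:
  assumes "\<And>i x y. i \<in> A \<Longrightarrow> i \<notin> B \<Longrightarrow> ends i = {x, y} \<Longrightarrow> (x, y) \<in> (adj ends B)\<^sup>*"
  shows "(adj ends A)\<^sup>* \<subseteq> (adj ends B)\<^sup>*"
proof -
  have "adj ends A \<subseteq> (adj ends B)\<^sup>*"
  proof clarify
    fix x y assume "(x, y) \<in> adj ends A"
    then obtain i where i: "i \<in> A" "ends i = {x, y}" by (auto simp: adj_def)
    show "(x, y) \<in> (adj ends B)\<^sup>*"
    proof (cases "i \<in> B")
      case True
      with i have "(x, y) \<in> adj ends B" by (auto simp: adj_def)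
      then show ?thesis ..
    qed (use i assms in blast)
  qed
  then show ?thesis by (metis rtrancl_idemp rtrancl_mono)
qed

text \<open>The first edge of the cycle will do: the rest of the cycle joins its endpoints and
  avoids it, because the edges of a cycle are distinct.\<close>

lemma has_cycle_redundant_edge:
  assumes "has_cycle ends T"
  obtains i where "i \<in> T" "(adj ends T)\<^sup>* \<subseteq> (adj ends (T - {i}))\<^sup>*"
proof -
  from assms obtain xs p where w: "walk ends T xs p" "p \<noteq> []" "hd xs = last xs" "distinct p"
    unfolding has_cycle_def by blast
  then obtain i q x ys where eq: "p = i # q" "xs = x # ys" "ys \<noteq> []"
    by (auto simp: walk_def length_Suc_conv neq_Nil_conv)
  then have i: "i \<in> T" "ends i = {x, hd ys}" "walk ends T ys q"
    using w by (simp_all add: walk_Cons)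
  have "set q \<subseteq> T - {i}" using walk_edges[OF i(3)] w(4) eq by auto
  from walk_imp_rtrancl[OF walk_subset[OF i(3) this]]
  have "(hd ys, x) \<in> (adj ends (T - {i}))\<^sup>*" using w(3) eq by simp
  then have "(a, b) \<in> (adj ends (T - {i}))\<^sup>*" if "ends i = {a, b}" for a b
    using i(2) that adj_rtrancl_sym by (metis doubleton_eq_iff)
  then have "(adj ends T)\<^sup>* \<subseteq> (adj ends (T - {i}))\<^sup>*"
    by (intro rtrancl_adj_replace_edges) auto
  with i(1) that show thesis by blast
qed

lemma has_cycle_mono: "has_cycle ends A \<Longrightarrow> A \<subseteq> B \<Longrightarrow> has_cycle ends B"
  unfolding has_cycle_def by (meson walk_edges walk_subset order_trans)

text \<open>Induction on the edges: \<open>X\<close> meets every component, and an edge that closes no cycle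
  merges the components of two different elements of \<open>X\<close>.\<close>

lemma forest_representatives:
  assumes "finite A" "finite S" "\<not> has_cycle ends A"
    and "\<And>i. i \<in> A \<Longrightarrow> \<exists>u\<in>S. \<exists>v\<in>S. ends i = {u, v}"
  shows "\<exists>X\<subseteq>S. card X + card A \<le> card S \<and> (\<forall>s\<in>S. \<exists>x\<in>X. (s, x) \<in> (adj ends A)\<^sup>*)"
  using assms
proof (induction A rule: finite_induct)
  case empty
  then show ?case by (intro exI[of _ S]) auto
next
  case (insert i A)
  let ?A = "insert i A"
  have "\<not> has_cycle ends A" using insert.prems(2) has_cycle_mono by blast
  with insert obtain X where X: "X \<subseteq> S" "card X + card A \<le> card S"
    "\<And>s. s \<in> S \<Longrightarrow> \<exists>x\<in>X. (s, x) \<in> (adj ends A)\<^sup>*" by auto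
  obtain u v where uv: "u \<in> S" "v \<in> S" "ends i = {u, v}" using insert.prems(3)[of i] by auto
  obtain x y where x: "x \<in> X" "(u, x) \<in> (adj ends A)\<^sup>*" and y: "y \<in> X" "(v, y) \<in> (adj ends A)\<^sup>*"
    using X(3) uv by meson
  have "(u, v) \<notin> (adj ends A)\<^sup>*"
    using acyclic_edge_is_bridge[OF insert.prems(2) _ uv(3)] insert.hyps(2) by simp
  then have "x \<noteq> y" using x(2) y(2) adj_rtrancl_sym rtrancl_trans by metis
  have sub: "(adj ends A)\<^sup>* \<subseteq> (adj ends ?A)\<^sup>*" by (intro rtrancl_mono adj_mono) auto
  have "(v, u) \<in> adj ends ?A" using uv(3) by (auto simp: adj_def insert_commute)
  then have yx: "(y, x) \<in> (adj ends ?A)\<^sup>*"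
    using x(2) y(2) sub by (meson adj_rtrancl_sym converse_rtrancl_into_rtrancl rtrancl_trans subsetD)
  have fX: "finite X" using X(1) insert.prems(1) finite_subset by blast
  have "\<exists>z\<in>X - {y}. (s, z) \<in> (adj ends ?A)\<^sup>*" if "s \<in> S" for s
  proof -
    obtain z where z: "z \<in> X" "(s, z) \<in> (adj ends ?A)\<^sup>*" using X(3)[OF \<open>s \<in> S\<close>] sub by blast
    show ?thesis
    proof (cases "z = y")
      case True
      then show ?thesis using z yx x(1) \<open>x \<noteq> y\<close> by (meson Diff_iff rtrancl_trans singletonD)
    qed (use z in blast)
  qed
  moreover have "card (X - {y}) + card ?A \<le> card S"
    using X(2) insert.hyps y(1) fX card_Suc_Diff1[OF fX y(1)] by simp
  ultimately show ?case using X(1) by (intro exI[of _ "X - {y}"]) auto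
qed

lemma forest_card_le:
  assumes "finite A" "finite S" "\<not> has_cycle ends A"
    and "\<And>i. i \<in> A \<Longrightarrow> \<exists>u\<in>S. \<exists>v\<in>S. ends i = {u, v}"
  shows "card A \<le> card S"
  using forest_representatives[of A S ends, OF assms] by auto

text \<open>The path is cut at its last visit to \<open>v\<close>. What follows avoids all edges at
  \<open>v\<close>, so it remains available after the edge \<open>f\<close> is deleted.\<close>

lemma rtrancl_adj_first_edge:
  assumes "(v, y) \<in> (adj ends C)\<^sup>*"
  shows "y = v \<or> (\<exists>f\<in>C. \<exists>x. ends f = {v, x} \<and> (x, y) \<in> (adj ends {i\<in>C. v \<notin> ends i})\<^sup>*)"
  using assms
proof (induction rule: rtrancl_induct)
  case (step y z)
  from step.hyps(2) obtain g where g: "g \<in> C" "ends g = {y, z}" by (auto simp: adj_def)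
  show ?case
  proof (cases "v \<in> ends g")
    case True
    \<comment> \<open>The path is at \<open>v\<close> again, either at its new end or just before
      it; all that precedes is discarded.\<close>
    with g have "z = v \<or> ends g = {v, z}" by auto
    with g(1) show ?thesis by blast
  next
    case False
    then have "(y, z) \<in> adj ends {i\<in>C. v \<notin> ends i}" "y \<noteq> v" using g by (auto simp: adj_def)
    with step.IH show ?thesis by (meson rtrancl.rtrancl_into_rtrancl)
  qed
qed simp

text \<open>A connected edge set minimizing the number of edges, those outside \<open>F\<close> counted twice, is a
  tree; if it had no \<open>F\<close>-edge at a vertex \<open>v\<close> of some \<open>F\<close>-edge, that edge could replace the first
  edge of a path from \<open>v\<close> to its other endpoint.\<close>

lemma spanning_tree_covering:
  assumes fin: "finite E" and conn: "connected_graph V ends E"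
    and F: "\<And>i. i \<in> F \<Longrightarrow> i \<in> E \<Longrightarrow> \<exists>u\<in>V. \<exists>v\<in>V. u \<noteq> v \<and> ends i = {u, v}"
  obtains T where "spanning_tree V ends E T"
    and "\<And>i v. i \<in> F \<Longrightarrow> i \<in> E \<Longrightarrow> v \<in> ends i \<Longrightarrow> \<exists>j\<in>T \<inter> F. v \<in> ends j"
proof -
  let ?P = "\<lambda>T. T \<subseteq> E \<and> connected_graph V ends T"
  let ?\<mu> = "\<lambda>T. card T + card (T - F)"
  have "?P E" using conn by simp
  then obtain T where T: "?P T" and min: "\<And>U. ?P U \<Longrightarrow> ?\<mu> T \<le> ?\<mu> U"
    using ex_has_least_nat[of ?P E ?\<mu>] by blast
  have finT: "finite T" using T fin finite_subset by blast
  have nocyc: "\<not> has_cycle ends T"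
  proof
    assume "has_cycle ends T"
    then obtain i where i: "i \<in> T" "(adj ends T)\<^sup>* \<subseteq> (adj ends (T - {i}))\<^sup>*"
      by (rule has_cycle_redundant_edge)
    then have "?P (T - {i})" using T unfolding connected_graph_iff by blast
    moreover have "card (T - {i}) < card T" using i(1) finT by (rule card_Diff1_less[rotated])
    moreover have "card (T - {i} - F) \<le> card (T - F)" using finT by (intro card_mono) auto
    ultimately show False using min[of "T - {i}"] by linarith
  qed
  have cover: "\<exists>j\<in>T \<inter> F. v \<in> ends j" if e: "e \<in> F" "e \<in> E" "v \<in> ends e" for e v
  proof (rule ccontr)
    assume none: "\<not> (\<exists>j\<in>T \<inter> F. v \<in> ends j)"
    then have "e \<notin> T" using e by blast
    obtain w where w: "w \<in> V" "v \<in> V" "w \<noteq> v" "ends e = {v, w}"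
      using F[OF e(1,2)] e(3) by (metis insert_commute insert_iff singletonD)
    then have "(v, w) \<in> (adj ends T)\<^sup>*" using T unfolding connected_graph_iff by blast
    from rtrancl_adj_first_edge[OF this] w(3) obtain f x where
      f: "f \<in> T" "ends f = {v, x}" "(x, w) \<in> (adj ends {i\<in>T. v \<notin> ends i})\<^sup>*" by blast
    have "f \<notin> F" using none f by blast
    \<comment> \<open>Exchanging \<open>f\<close> for \<open>e\<close> keeps the number of edges and
      lowers the number of edges outside \<open>F\<close>.\<close>
    let ?U = "insert e (T - {f})"
    \<comment> \<open>Since \<open>f\<close> meets \<open>v\<close>, the rest of the path survives
      the deletion of \<open>f\<close>. Continued by \<open>e\<close>, it leads from
      \<open>x\<close> back to \<open>v\<close> and so bridges \<open>f\<close>.\<close>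
    have "adj ends {i\<in>T. v \<notin> ends i} \<subseteq> adj ends ?U" using f(2) by (intro adj_mono) auto
    then have "(x, w) \<in> (adj ends ?U)\<^sup>*" using f(3) rtrancl_mono by blast
    moreover have "(w, v) \<in> adj ends ?U" using w(4) by (auto simp: adj_def insert_commute)
    ultimately have xv: "(x, v) \<in> (adj ends ?U)\<^sup>*" by (rule rtrancl_into_rtrancl)
    have "(a, b) \<in> (adj ends ?U)\<^sup>*" if "i \<in> T" "i \<notin> ?U" "ends i = {a, b}" for i a b
    proof -
      have "i = f" using that by auto
      then show ?thesis using that f(2) xv adj_rtrancl_sym by (metis doubleton_eq_iff)
    qed
    then have "(adj ends T)\<^sup>* \<subseteq> (adj ends ?U)\<^sup>*" by (rule rtrancl_adj_replace_edges)
    then have "?P ?U" using T e(2) unfolding connected_graph_iff by blast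
    moreover have "card ?U = card T"
      using finT f(1) \<open>e \<notin> T\<close> card_Suc_Diff1[OF finT f(1)] by simp
    moreover have "card (?U - F) < card (T - F)"
      using finT f(1) \<open>f \<notin> F\<close> e(1) by (intro psubset_card_mono) auto
    ultimately show False using min[of ?U] by linarith
  qed
  show thesis
    using that[of T] T nocyc cover by (auto simp: spanning_tree_def)
qed

section \<open>The reduction\<close>

text \<open>The edges of \<open>H\<close> come before the star, so they occupy exactly the positions
  below \<open>m\<close>, and the answer of the interdiction algorithm starts with their bits. The
  star cost exceeds the budget even for \<open>b = 0\<close>.\<close>

definition dks_to_mst :: "dks_instance \<Rightarrow> mst_instance" where
  "dks_to_mst H =
     (let b = length (dks_edges H) - dks_k H in
      \<lparr>mst_nodes = dks_nodes H,
       mst_edges =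
         rev (map (\<lambda>(u, v). (u, v, 1, 1)) (dks_edges H)) @
         rev (map (\<lambda>v. (hd (dks_nodes H), v, 0, of_nat (2 * b + 1))) (tl (dks_nodes H))),
       budget = of_nat b\<rparr>)"

text \<open>The solution handed back for \<open>H\<close>. Nodes that meet no surviving edge are
  left out, as they would enlarge the set without adding edges.\<close>

definition kept_nodes :: "dks_instance \<Rightarrow> nat set \<Rightarrow> nat set" where
  "kept_nodes H R = (\<Union>i \<in> {..<length (dks_edges H)} - R. edge_ends (dks_to_mst H) i)"

locale dks =
  fixes H :: dks_instance
  assumes dks_instance: "H \<in> dks_instances"
begin

abbreviation "m \<equiv> length (dks_edges H)"
abbreviation "I \<equiv> dks_to_mst H"
abbreviation "V \<equiv> set (dks_nodes H)"
abbreviation "ends \<equiv> edge_ends I"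

section \<open>Structure of the constructed instance\<close>

lemma nodes: "dks_nodes H \<noteq> []" "distinct (dks_nodes H)"
  and edges: "\<And>u v. (u, v) \<in> set (dks_edges H) \<Longrightarrow> u \<in> V \<and> v \<in> V \<and> u \<noteq> v"
  and simple: "distinct (map (\<lambda>(u, v). {u, v}) (dks_edges H))"
  and k_le: "dks_k H \<le> m"
  using dks_instance by (auto simp: dks_instances_def)

lemma mst_nodes_I: "mst_nodes I = dks_nodes H"
  and budget_I: "budget I = of_nat (m - dks_k H)"
  by (simp_all add: dks_to_mst_def Let_def)

lemma length_mst_edges: "length (mst_edges I) = m + length (dks_nodes H) - 1"
  using nodes(1) by (cases "dks_nodes H") (simp_all add: dks_to_mst_def Let_def)

lemma graph_edge:
  assumes "i < m"
  obtains u v where "(u, v) \<in> set (dks_edges H)" "rev (dks_edges H) ! i = (u, v)"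
    "mst_edges I ! i = (u, v, 1, 1)"
proof -
  obtain u v where uv: "rev (dks_edges H) ! i = (u, v)" by fastforce
  then have "(u, v) \<in> set (dks_edges H)" by (metis assms length_rev nth_mem set_rev)
  moreover have "mst_edges I ! i = (u, v, 1, 1)"
    using uv assms by (simp add: dks_to_mst_def Let_def nth_append rev_map)
  ultimately show thesis using that uv by blast
qed

lemma star_edge:
  assumes "m \<le> i" "i < length (mst_edges I)"
  shows "mst_edges I ! i = (hd (dks_nodes H), rev (tl (dks_nodes H)) ! (i - m), 0,
           of_nat (2 * (m - dks_k H) + 1))"
    and "rev (tl (dks_nodes H)) ! (i - m) \<in> set (tl (dks_nodes H))"
proof -
  have l: "i - m < length (rev (tl (dks_nodes H)))"
    using assms length_mst_edges by auto
  from nth_mem[OF l] show "rev (tl (dks_nodes H)) ! (i - m) \<in> set (tl (dks_nodes H))" by simp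
  show "mst_edges I ! i = (hd (dks_nodes H), rev (tl (dks_nodes H)) ! (i - m), 0,
           of_nat (2 * (m - dks_k H) + 1))"
    using assms l by (simp add: dks_to_mst_def Let_def nth_append rev_map)
qed

lemma graph_edge_attributes:
  assumes "i < m"
  shows "edge_weight I i = 1" "edge_cost I i = 1"
    and "ends i \<in> dks_edge_set H"
    and "\<exists>u\<in>V. \<exists>v\<in>V. u \<noteq> v \<and> ends i = {u, v}"
proof -
  obtain u v where uv: "(u, v) \<in> set (dks_edges H)" "mst_edges I ! i = (u, v, 1, 1)"
    using graph_edge[OF assms] by blast
  then show "edge_weight I i = 1" "edge_cost I i = 1" "ends i \<in> dks_edge_set H"
    by (force simp: edge_weight_def edge_cost_def edge_ends_def dks_edge_set_def)+
  show "\<exists>u\<in>V. \<exists>v\<in>V. u \<noteq> v \<and> ends i = {u, v}"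
    using uv edges by (intro bexI[of _ u] bexI[of _ v]) (auto simp: edge_ends_def)
qed

text \<open>This is where simplicity of \<open>H\<close> enters: it lets edges be counted by their
  positions, so the bound \<open>k\<close> on edges becomes a bound on sets of positions.\<close>

lemma inj_on_graph_ends: "inj_on ends {..<m}"
proof -
  have e: "ends i = rev (map (\<lambda>(u, v). {u, v}) (dks_edges H)) ! i" if "i < m" for i
  proof -
    obtain u v where "rev (dks_edges H) ! i = (u, v)" "mst_edges I ! i = (u, v, 1, 1)"
      using graph_edge[OF \<open>i < m\<close>] by blast
    then show ?thesis using that by (simp add: edge_ends_def rev_map)
  qed
  have "distinct (rev (map (\<lambda>(u, v). {u, v}) (dks_edges H)))" using simple by simp
  then show ?thesis by (intro inj_onI) (simp add: e nth_eq_iff_index_eq)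
qed

lemma dks_edge_set_eq: "dks_edge_set H = ends ` {..<m}"
proof -
  have "dks_edge_set H \<subseteq> ends ` {..<m}"
  proof
    fix e assume "e \<in> dks_edge_set H"
    then obtain u v where uv: "(u, v) \<in> set (rev (dks_edges H))" "e = {u, v}"
      by (auto simp: dks_edge_set_def)
    then obtain i where i: "i < m" "rev (dks_edges H) ! i = (u, v)"
      by (metis in_set_conv_nth length_rev)
    then have "mst_edges I ! i = (u, v, 1, 1)" using graph_edge[OF i(1)] by auto
    with uv(2) have "e = ends i" by (simp add: edge_ends_def)
    with i show "e \<in> ends ` {..<m}" by blast
  qed
  then show ?thesis using graph_edge_attributes(3) by auto
qed

lemma card_graph_ends:
  assumes "J \<subseteq> {..<m}"
  shows "card (ends ` J) = card J"
  using inj_on_graph_ends assms by (meson card_image inj_on_subset)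

lemma star_edge_attributes:
  assumes "m \<le> i" "i < length (mst_edges I)"
  shows "edge_weight I i = 0" "edge_cost I i = of_nat (2 * (m - dks_k H) + 1)"
  using star_edge[OF assms] by (simp_all add: edge_weight_def edge_cost_def)

lemma edge_ids_I: "edge_ids I = {..<length (mst_edges I)}" "m \<le> length (mst_edges I)"
  using nodes(1) length_mst_edges by (cases "dks_nodes H"; auto simp: edge_ids_def)+

text \<open>A single star edge breaks the budget, and no negative cost can make up for it. The edges
  of \<open>H\<close> cost 1 each, so among them the budget is a bound on the cardinality.\<close>

lemma interdiction_sets_I:
  "interdiction_sets I = {R. R \<subseteq> {..<m} \<and> card R \<le> m - dks_k H}"
proof (intro set_eqI iffI)
  fix R assume "R \<in> interdiction_sets I"
  then have R: "R \<subseteq> edge_ids I" "(\<Sum>i\<in>R. edge_cost I i) \<le> of_nat (m - dks_k H)"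
    by (auto simp: interdiction_sets_def budget_I)
  have fin: "finite R" using R(1) finite_subset by (auto simp: edge_ids_I)
  have nonneg: "0 \<le> edge_cost I i" if "i \<in> R" for i
    using that R(1) graph_edge_attributes star_edge_attributes
    by (cases "i < m") (auto simp: edge_ids_I)
  have sub: "R \<subseteq> {..<m}"
  proof
    fix i assume i: "i \<in> R"
    show "i \<in> {..<m}"
    proof (rule ccontr)
      assume "i \<notin> {..<m}"
      then have "edge_cost I i = of_nat (2 * (m - dks_k H) + 1)"
        using star_edge_attributes[of i] i R(1) by (auto simp: edge_ids_I)
      moreover have "edge_cost I i \<le> (\<Sum>i\<in>R. edge_cost I i)"
        using i fin nonneg by (intro member_le_sum) auto
      ultimately have "(of_nat (2 * (m - dks_k H) + 1) :: rat) \<le> of_nat (m - dks_k H)"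
        using R(2) by linarith
      then show False unfolding of_nat_le_iff by simp
    qed
  qed
  have "(\<Sum>i\<in>R. edge_cost I i) = (\<Sum>i\<in>R. 1)"
    using sub graph_edge_attributes by (intro sum.cong) auto
  with R(2) have "(of_nat (card R) :: rat) \<le> of_nat (m - dks_k H)" by simp
  with sub show "R \<in> {R. R \<subseteq> {..<m} \<and> card R \<le> m - dks_k H}"
    unfolding of_nat_le_iff by simp
next
  fix R assume "R \<in> {R. R \<subseteq> {..<m} \<and> card R \<le> m - dks_k H}"
  then have R: "R \<subseteq> {..<m}" "card R \<le> m - dks_k H" by auto
  have "(\<Sum>i\<in>R. edge_cost I i) = (\<Sum>i\<in>R. 1)"
    using R(1) graph_edge_attributes by (intro sum.cong) auto
  moreover have "(of_nat (card R) :: rat) \<le> of_nat (m - dks_k H)"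
    using R(2) unfolding of_nat_le_iff .
  ultimately show "R \<in> interdiction_sets I"
    using R(1) edge_ids_I by (auto simp: interdiction_sets_def budget_I)
qed

lemma connected_remaining:
  assumes "R \<subseteq> {..<m}"
  shows "connected_graph V ends (edge_ids I - R)"
proof -
  let ?v = "hd (dks_nodes H)"
  let ?A = "adj ends (edge_ids I - R)"
  have *: "(?v, x) \<in> ?A\<^sup>*" if "x \<in> V" for x
  proof (cases "x = ?v")
    case False
    have "V = insert ?v (set (tl (dks_nodes H)))"
      using nodes(1) by (metis list.exhaust_sel list.simps(15))
    with that False have "x \<in> set (rev (tl (dks_nodes H)))" by auto
    then obtain j where j: "j < length (rev (tl (dks_nodes H)))" "rev (tl (dks_nodes H)) ! j = x"
      by (metis in_set_conv_nth)
    then have l: "m + j < length (mst_edges I)" using length_mst_edges by simp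
    have "ends (m + j) = {?v, x}"
      using star_edge(1)[OF _ l] j by (simp add: edge_ends_def)
    moreover have "m + j \<in> edge_ids I - R" using assms l by (auto simp: edge_ids_I)
    ultimately have "(?v, x) \<in> ?A" by (auto simp: adj_def)
    then show ?thesis ..
  qed simp
  show ?thesis unfolding connected_graph_iff
    using * adj_rtrancl_sym rtrancl_trans by metis
qed

lemma tree_weight:
  assumes "T \<in> remaining_trees I R"
  shows "(\<Sum>i\<in>T. edge_weight I i) = of_nat (card (T \<inter> {..<m}))"
proof -
  have T: "T \<subseteq> {..<length (mst_edges I)}"
    using assms by (auto simp: remaining_trees_def spanning_tree_def edge_ids_I)
  then have fin: "finite T" using finite_subset by blast
  have "(\<Sum>i\<in>T. edge_weight I i) = (\<Sum>i\<in>T \<inter> {..<m}. edge_weight I i)"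
    using T star_edge_attributes(1)
    by (intro sum.mono_neutral_right fin) (auto simp: subset_iff, meson not_le)
  also have "\<dots> = (\<Sum>i\<in>T \<inter> {..<m}. 1)"
    using graph_edge_attributes(1) by (intro sum.cong) auto
  finally show ?thesis by simp
qed

lemma finite_remaining_trees: "finite (remaining_trees I R)"
proof -
  have "remaining_trees I R \<subseteq> Pow {..<length (mst_edges I)}"
    by (auto simp: remaining_trees_def spanning_tree_def edge_ids_I)
  then show ?thesis using finite_subset by blast
qed

text \<open>The loss of the factor 2: the edges of \<open>H\<close> in the tree cover all kept
  nodes, and each of them covers only two.\<close>

lemma tree_covering_kept_nodes:
  assumes "R \<subseteq> {..<m}"
  obtains T where "T \<in> remaining_trees I R" "card (kept_nodes H R) \<le> 2 * card (T \<inter> {..<m})"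
proof -
  obtain T where T: "spanning_tree V ends (edge_ids I - R) T"
    and cover: "\<And>i v. i \<in> {..<m} \<Longrightarrow> i \<in> edge_ids I - R \<Longrightarrow> v \<in> ends i \<Longrightarrow>
      \<exists>j\<in>T \<inter> {..<m}. v \<in> ends j"
  proof (rule spanning_tree_covering[where F = "{..<m}"])
    show "finite (edge_ids I - R)" by (simp add: edge_ids_I)
    show "connected_graph V ends (edge_ids I - R)" by (rule connected_remaining[OF assms])
    show "\<exists>u\<in>V. \<exists>v\<in>V. u \<noteq> v \<and> ends i = {u, v}" if "i \<in> {..<m}" for i
      using graph_edge_attributes(4) that by simp
  qed blast
  have "kept_nodes H R \<subseteq> (\<Union>j\<in>T \<inter> {..<m}. ends j)"
  proof
    fix v assume "v \<in> kept_nodes H R"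
    then obtain i where "i < m" "i \<notin> R" "v \<in> ends i" by (auto simp: kept_nodes_def)
    then show "v \<in> (\<Union>j\<in>T \<inter> {..<m}. ends j)"
      using cover[of i v] edge_ids_I by auto
  qed
  moreover have fin2: "finite (ends j) \<and> card (ends j) \<le> 2" if "j < m" for j
    using graph_edge_attributes(4)[OF that] by auto
  ultimately have "card (kept_nodes H R) \<le> card (\<Union>j\<in>T \<inter> {..<m}. ends j)"
    by (intro card_mono) auto
  also have "\<dots> \<le> (\<Sum>j\<in>T \<inter> {..<m}. card (ends j))"
    by (intro card_UN_le) auto
  also have "\<dots> \<le> (\<Sum>j\<in>T \<inter> {..<m}. 2)"
    using fin2 by (intro sum_mono) auto
  finally have "card (kept_nodes H R) \<le> 2 * card (T \<inter> {..<m})" by simp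
  moreover have "T \<in> remaining_trees I R" using T by (simp add: remaining_trees_def mst_nodes_I)
  ultimately show thesis using that by blast
qed

text \<open>The condition with content is that every affordable removal leaves a spanning tree; the
  covering tree is a witness.\<close>

lemma dks_to_mst_instance: "I \<in> mst_instances"
proof -
  have "\<forall>(u, v, w, c) \<in> set (mst_edges I). u \<in> V \<and> v \<in> V \<and> u \<noteq> v \<and> 0 \<le> w \<and> 0 \<le> c"
  proof
    fix e assume "e \<in> set (mst_edges I)"
    then obtain i where i: "i < length (mst_edges I)" "e = mst_edges I ! i"
      by (metis in_set_conv_nth)
    show "case e of (u, v, w, c) \<Rightarrow> u \<in> V \<and> v \<in> V \<and> u \<noteq> v \<and> 0 \<le> w \<and> 0 \<le> c"
    proof (cases "i < m")
      case True
      then obtain u v where "(u, v) \<in> set (dks_edges H)" "mst_edges I ! i = (u, v, 1, 1)"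
        using graph_edge[OF True] by blast
      then show ?thesis using edges i(2) by auto
    next
      case False
      have "hd (dks_nodes H) \<in> V" "x \<in> set (tl (dks_nodes H)) \<Longrightarrow> x \<in> V \<and> hd (dks_nodes H) \<noteq> x" for x
        using nodes by (cases "dks_nodes H"; auto)+
      then show ?thesis using star_edge[of i] False i by simp
    qed
  qed
  moreover have "remaining_trees I R \<noteq> {}" if "R \<in> interdiction_sets I" for R
  proof -
    have "R \<subseteq> {..<m}" using that by (simp add: interdiction_sets_I)
    then show ?thesis using tree_covering_kept_nodes[of R] by blast
  qed
  ultimately show ?thesis
    using nodes by (simp add: mst_instances_def mst_nodes_I budget_I)
qed

section \<open>Comparison of the two objectives\<close>

lemma kept_nodes_le_max_tree_weight:
  assumes "R \<in> interdiction_sets I"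
  shows "real (card (kept_nodes H R)) \<le> 2 * real_of_rat (max_tree_weight I R)"
proof -
  obtain T where T: "T \<in> remaining_trees I R" "card (kept_nodes H R) \<le> 2 * card (T \<inter> {..<m})"
    using tree_covering_kept_nodes[of R] assms unfolding interdiction_sets_I by blast
  have "(\<Sum>i\<in>T. edge_weight I i) \<le> max_tree_weight I R"
    unfolding max_tree_weight_def using T(1) finite_remaining_trees by (intro Max_ge) auto
  then have "real_of_rat (of_nat (card (T \<inter> {..<m}))) \<le> real_of_rat (max_tree_weight I R)"
    unfolding tree_weight[OF T(1)] of_rat_less_eq .
  with T(2) show ?thesis by simp
qed

text \<open>All edges of \<open>H\<close> not inside \<open>S\<close> are removed; this is
  affordable because at least \<open>k\<close> edges lie inside \<open>S\<close>. In every remaining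
  tree the edges of \<open>H\<close> form a forest on \<open>S\<close>, which bounds all tree
  weights at once and hence their maximum.\<close>

lemma max_tree_weight_le:
  assumes "S \<in> dks_feasible H"
  obtains R where "R \<in> interdiction_sets I" "real_of_rat (max_tree_weight I R) \<le> real (card S)"
proof -
  define J where "J = {i. i < m \<and> ends i \<subseteq> S}"
  define R where "R = {..<m} - J"
  have S: "S \<subseteq> V" "dks_k H \<le> card {e \<in> dks_edge_set H. e \<subseteq> S}"
    using assms by (auto simp: dks_feasible_def)
  have J: "J \<subseteq> {..<m}" by (auto simp: J_def)
  have "{e \<in> dks_edge_set H. e \<subseteq> S} = ends ` J" by (auto simp: dks_edge_set_eq J_def)
  with S(2) card_graph_ends[OF J] have kJ: "dks_k H \<le> card J" by simp
  have "card R = m - card J"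
    unfolding R_def using J by (simp add: card_Diff_subset finite_subset)
  with kJ have R: "R \<in> interdiction_sets I" by (auto simp: interdiction_sets_I R_def)
  have ne: "remaining_trees I R \<noteq> {}" using dks_to_mst_instance R by (simp add: mst_instances_def)
  have "max_tree_weight I R \<le> of_nat (card S)"
    unfolding max_tree_weight_def
  proof (intro Max.boundedI)
    fix w assume "w \<in> (\<lambda>T. \<Sum>i\<in>T. edge_weight I i) ` remaining_trees I R"
    then obtain T where T: "T \<in> remaining_trees I R" "w = (\<Sum>i\<in>T. edge_weight I i)" by blast
    then have st: "T \<subseteq> edge_ids I - R" "\<not> has_cycle ends T"
      by (auto simp: remaining_trees_def spanning_tree_def)
    have "card (T \<inter> {..<m}) \<le> card S"
    proof (rule forest_card_le)
      show "finite S" using S(1) finite_subset by blast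
      show "\<not> has_cycle ends (T \<inter> {..<m})" using st(2) has_cycle_mono by blast
      fix i assume i: "i \<in> T \<inter> {..<m}"
      then have "ends i \<subseteq> S" using st(1) by (auto simp: R_def J_def)
      then show "\<exists>u\<in>S. \<exists>v\<in>S. ends i = {u, v}"
        using graph_edge_attributes(4)[of i] i by auto
    qed simp
    then show "w \<le> of_nat (card S)" using T(2) tree_weight[OF T(1)] by simp
  qed (use ne finite_remaining_trees in auto)
  then have "real_of_rat (max_tree_weight I R) \<le> real_of_rat (of_nat (card S))"
    unfolding of_rat_less_eq .
  with R that show thesis by simp
qed

lemma kept_nodes_feasible:
  assumes "R \<in> interdiction_sets I"
  shows "kept_nodes H R \<in> dks_feasible H"
proof -
  let ?J = "{..<m} - R"
  have R: "R \<subseteq> {..<m}" "card R \<le> m - dks_k H" using assms by (auto simp: interdiction_sets_I)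
  have "dks_k H \<le> card ?J"
    using R k_le by (simp add: card_Diff_subset finite_subset)
  also have "\<dots> = card (ends ` ?J)" by (rule card_graph_ends[symmetric]) auto
  also have "\<dots> \<le> card {e \<in> dks_edge_set H. e \<subseteq> kept_nodes H R}"
    by (intro card_mono) (auto simp: dks_edge_set_eq kept_nodes_def)
  finally have "dks_k H \<le> card {e \<in> dks_edge_set H. e \<subseteq> kept_nodes H R}" .
  moreover have "kept_nodes H R \<subseteq> V"
    using graph_edge_attributes(4) by (fastforce simp: kept_nodes_def)
  ultimately show ?thesis by (simp add: dks_feasible_def)
qed

text \<open>The chain is: kept nodes, twice the tree weight, \<open>2 * a\<close> times the
  interdiction optimum, \<open>2 * a\<close> times the densest-subgraph optimum. Only its last link
  depends on the sign of \<open>a\<close>.\<close>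

lemma kept_nodes_approx:
  assumes R: "R \<in> interdiction_sets I"
    and approx: "real_of_rat (max_tree_weight I R) \<le> a * optimum mst_interdiction I"
  shows "real (card (kept_nodes H R)) \<le> 2 * a * optimum min_dks H"
proof -
  let ?X = "(\<lambda>R. real_of_rat (max_tree_weight I R)) ` interdiction_sets I"
  let ?Y = "(\<lambda>S. real (card S)) ` dks_feasible H"
  have opt_mst: "optimum mst_interdiction I = Min ?X"
    and opt_dks: "optimum min_dks H = Min ?Y"
    by (simp_all add: optimum_def mst_interdiction_def min_dks_def)
  have finX: "finite ?X" by (auto simp: interdiction_sets_I intro: finite_subset[of _ "Pow {..<m}"])
  have finY: "finite ?Y" by (auto simp: dks_feasible_def intro: finite_subset[of _ "Pow V"])
  have "?X \<noteq> {}" "?Y \<noteq> {}" using R kept_nodes_feasible by blast+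
  from Min_in[OF finX this(1)] Min_in[OF finY this(2)] obtain R' S where
    R': "R' \<in> interdiction_sets I" "Min ?X = real_of_rat (max_tree_weight I R')" and
    S: "S \<in> dks_feasible H" "Min ?Y = real (card S)" by auto
  have le: "Min ?X \<le> Min ?Y"
  proof -
    obtain R'' where "R'' \<in> interdiction_sets I" "real_of_rat (max_tree_weight I R'') \<le> real (card S)"
      using max_tree_weight_le[OF S(1)] .
    then show ?thesis unfolding S(2) using finX by (meson Min_le image_eqI order_trans)
  qed
  have X0: "0 \<le> Min ?X" using kept_nodes_le_max_tree_weight[OF R'(1)] R'(2) by linarith
  have bound: "real (card (kept_nodes H R)) \<le> 2 * (a * Min ?X)"
    using kept_nodes_le_max_tree_weight[OF R] approx unfolding opt_mst by linarith
  show ?thesis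
  proof (cases "0 \<le> a")
    case True
    then have "a * Min ?X \<le> a * Min ?Y" using le by (rule mult_left_mono[rotated])
    with bound opt_dks show ?thesis by simp
  next
    case False
    \<comment> \<open>A cardinality is nonnegative, so with \<open>a < 0\<close> and
      \<open>0 \<le> Min ?X\<close> the interdiction optimum is 0. The set of kept nodes is then
      empty, and as it is feasible, the other optimum is 0 as well.\<close>
    have "0 \<le> a * Min ?X" using bound by linarith
    with False X0 have "Min ?X = 0" by (simp add: zero_le_mult_iff)
    with bound have z: "card (kept_nodes H R) = 0" by simp
    have "Min ?Y \<le> real (card (kept_nodes H R))"
      using kept_nodes_feasible[OF R] finY by (intro Min_le) auto
    then have "Min ?Y = 0" using z S(2) by simp
    with z opt_dks show ?thesis by simp
  qed
qed

end

section \<open>Running times of WHILE programs\<close>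

fun expr_vars :: "expr \<Rightarrow> nat set" where
  "expr_vars (Var x) = {x}"
| "expr_vars (Const d) = {}"
| "expr_vars (Cons e f) = expr_vars e \<union> expr_vars f"
| "expr_vars (Hd e) = expr_vars e"
| "expr_vars (Tl e) = expr_vars e"
| "expr_vars (Eq e f) = expr_vars e \<union> expr_vars f"

fun com_vars :: "com \<Rightarrow> nat set" where
  "com_vars Skip = {}"
| "com_vars (Assign x e) = insert x (expr_vars e)"
| "com_vars (Seq c d) = com_vars c \<union> com_vars d"
| "com_vars (Cond e c d) = expr_vars e \<union> com_vars c \<union> com_vars d"
| "com_vars (While e c) = expr_vars e \<union> com_vars c"

fun writes :: "com \<Rightarrow> nat set" where
  "writes Skip = {}"
| "writes (Assign x e) = {x}"
| "writes (Seq c d) = writes c \<union> writes d"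
| "writes (Cond e c d) = writes c \<union> writes d"
| "writes (While e c) = writes c"

lemma finite_com_vars: "finite (com_vars c)"
proof -
  have "finite (expr_vars e)" for e by (induction e) auto
  then show ?thesis by (induction c) auto
qed

lemma writes_subset_com_vars: "writes c \<subseteq> com_vars c"
  by (induction c) auto

lemma expr_agree:
  "\<forall>x\<in>expr_vars e. s x = u x \<Longrightarrow>
     eval_expr e s = eval_expr e u \<and> time_expr e s = time_expr e u"
  by (induction e) auto

lemma exec_frame: "exec c s t s' \<Longrightarrow> x \<notin> writes c \<Longrightarrow> s' x = s x"
  by (induction rule: exec.induct) auto

text \<open>Lets the interdiction algorithm run in a store whose higher registers hold data of the
  reduction, although its specification speaks of an otherwise empty store. Time is preserved
  exactly.\<close>

lemma exec_agree:
  assumes "exec c s t s'" "com_vars c \<subseteq> V" "\<forall>x\<in>V. s x = u x"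
  shows "\<exists>u'. exec c u t u' \<and> (\<forall>x\<in>V. s' x = u' x)"
  using assms
proof (induction arbitrary: u rule: exec.induct)
  case (Skip s)
  then show ?case using exec.Skip by blast
next
  case (Assign x e s)
  then have "eval_expr e s = eval_expr e u \<and> time_expr e s = time_expr e u"
    by (intro expr_agree) auto
  then show ?case using exec.Assign[of x e u] Assign.prems(2) by force
next
  case (Seq c1 s1 t1 s2 c2 t2 s3)
  then show ?case by (metis com_vars.simps(3) exec.Seq le_sup_iff)
next
  case (CondTrue e s c1 t s' c2)
  then have "eval_expr e s = eval_expr e u \<and> time_expr e s = time_expr e u"
    by (intro expr_agree) auto
  moreover obtain u' where "exec c1 u t u'" "\<forall>x\<in>V. s' x = u' x"
    using CondTrue.IH[of u] CondTrue.prems by auto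
  ultimately show ?case using CondTrue.hyps(1) exec.CondTrue[of e u c1 t u' c2] by auto
next
  case (CondFalse e s c2 t s' c1)
  then have "eval_expr e s = eval_expr e u \<and> time_expr e s = time_expr e u"
    by (intro expr_agree) auto
  moreover obtain u' where "exec c2 u t u'" "\<forall>x\<in>V. s' x = u' x"
    using CondFalse.IH[of u] CondFalse.prems by auto
  ultimately show ?case using CondFalse.hyps(1) exec.CondFalse[of e u c2 t u' c1] by auto
next
  case (WhileFalse e s c)
  then have "eval_expr e s = eval_expr e u \<and> time_expr e s = time_expr e u"
    by (intro expr_agree) auto
  then show ?case using WhileFalse exec.WhileFalse[of e u c] by auto
next
  case (WhileTrue e s1 c t1 s2 t2 s3)
  then have e: "eval_expr e s1 = eval_expr e u \<and> time_expr e s1 = time_expr e u"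
    by (intro expr_agree) auto
  obtain u2 where u2: "exec c u t1 u2" "\<forall>x\<in>V. s2 x = u2 x"
    using WhileTrue.IH(1)[of u] WhileTrue.prems by auto
  obtain u3 where u3: "exec (While e c) u2 t2 u3" "\<forall>x\<in>V. s3 x = u3 x"
    using WhileTrue.IH(2)[OF WhileTrue.prems(1) u2(2)] by blast
  then show ?case using WhileTrue.hyps(1) exec.WhileTrue[OF _ u2(1) u3(1)] e by metis
qed

text \<open>Coefficients of bounds linear in \<open>Suc M\<close>, where \<open>M\<close> bounds the
  sizes of the variables. Since \<open>size_eval_expr\<close> is strict, the extra node made by
  \<open>Cons\<close> is absorbed and weights simply add up.\<close>

fun expr_weight :: "expr \<Rightarrow> nat" where
  "expr_weight (Var x) = 1"
| "expr_weight (Const d) = 1 + size d"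
| "expr_weight (Cons e f) = expr_weight e + expr_weight f"
| "expr_weight (Hd e) = expr_weight e"
| "expr_weight (Tl e) = expr_weight e"
| "expr_weight (Eq e f) = 2"

text \<open>The unit charged for each subexpression is again paid for by the strictness of
  \<open>size_eval_expr\<close>.\<close>

fun expr_cost :: "expr \<Rightarrow> nat" where
  "expr_cost (Var x) = 1"
| "expr_cost (Const d) = 1 + size d"
| "expr_cost (Cons e f) = expr_cost e + expr_cost f + expr_weight e + expr_weight f"
| "expr_cost (Hd e) = expr_cost e + expr_weight e"
| "expr_cost (Tl e) = expr_cost e + expr_weight e"
| "expr_cost (Eq e f) = expr_cost e + expr_cost f + 2"

lemma size_hd_data: "size (hd_data d) \<le> size d" by (cases d) auto
lemma size_tl_data: "size (tl_data d) \<le> size d" by (cases d) auto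
lemma size_enc_bool: "size (enc_bool b) \<le> 1" by (simp add: enc_bool_def)

lemma size_eval_expr:
  "\<forall>x\<in>expr_vars e. size (s x) \<le> M \<Longrightarrow> size (eval_expr e s) < expr_weight e * Suc M"
proof (induction e)
  case (Cons e f)
  then show ?case by (simp add: add_mult_distrib)
next
  case (Hd e)
  then show ?case using size_hd_data le_less_trans by simp blast
next
  case (Tl e)
  then show ?case using size_tl_data le_less_trans by simp blast
next
  case (Eq e f)
  show ?case using size_enc_bool[of "eval_expr e s = eval_expr f s"] by simp
qed auto

lemma time_expr_le:
  "\<forall>x\<in>expr_vars e. size (s x) \<le> M \<Longrightarrow> time_expr e s \<le> expr_cost e * Suc M"
proof (induction e)
  case (Cons e f)
  then show ?case using size_eval_expr[of "Cons e f" s M]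
    by (simp add: add_mult_distrib del: mult_Suc_right)
next
  case (Hd e)
  then show ?case using size_eval_expr[of "Hd e" s M]
    by (simp add: add_mult_distrib del: mult_Suc_right)
next
  case (Tl e)
  then show ?case using size_eval_expr[of "Tl e" s M]
    by (simp add: add_mult_distrib del: mult_Suc_right)
next
  case (Eq e f)
  then show ?case using size_enc_bool[of "eval_expr e s = eval_expr f s"]
    by (simp add: add_mult_distrib del: mult_Suc_right)
qed auto

text \<open>Total correctness with a time budget from a given store. Preservation of the unwritten
  registers is built in, so a postcondition has to mention only what changes.\<close>

definition runs :: "com \<Rightarrow> store \<Rightarrow> nat \<Rightarrow> (store \<Rightarrow> bool) \<Rightarrow> bool" where
  "runs c s T Q \<longleftrightarrow>
     (\<exists>t s'. exec c s t s' \<and> t \<le> T \<and> (\<forall>v. v \<notin> writes c \<longrightarrow> s' v = s v) \<and> Q s')"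

lemma runsI: "exec c s t s' \<Longrightarrow> t \<le> T \<Longrightarrow> Q s' \<Longrightarrow> runs c s T Q"
  unfolding runs_def using exec_frame by blast

lemma runs_weaken: "runs c s T Q \<Longrightarrow> T \<le> T' \<Longrightarrow> (\<And>s'. Q s' \<Longrightarrow> Q' s') \<Longrightarrow> runs c s T' Q'"
  unfolding runs_def by (meson order_trans)

lemma runs_Skip: "0 < T \<Longrightarrow> Q s \<Longrightarrow> runs Skip s T Q"
  by (rule runsI[OF exec.Skip]) auto

lemma runs_Assign:
  "\<forall>v\<in>expr_vars e. size (s v) \<le> M \<Longrightarrow> Q (s(x := eval_expr e s)) \<Longrightarrow>
     runs (Assign x e) s (expr_cost e * Suc M) Q"
  by (rule runsI[OF exec.Assign time_expr_le])

lemma runs_Seq: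
  assumes "runs c s T P"
    and "\<And>s'. P s' \<Longrightarrow> \<forall>v. v \<notin> writes c \<longrightarrow> s' v = s v \<Longrightarrow> runs d s' U Q"
  shows "runs (Seq c d) s (T + U) Q"
proof -
  obtain t s' where 1: "exec c s t s'" "t \<le> T" "\<forall>v. v \<notin> writes c \<longrightarrow> s' v = s v" "P s'"
    using assms(1) unfolding runs_def by blast
  obtain u s'' where 2: "exec d s' u s''" "u \<le> U" "Q s''"
    using assms(2)[OF 1(4,3)] unfolding runs_def by blast
  show ?thesis by (rule runsI[OF exec.Seq[OF 1(1) 2(1)]]) (use 1 2 in auto)
qed

lemma runs_Cond:
  assumes "\<forall>v\<in>expr_vars e. size (s v) \<le> M"
    and "eval_expr e s \<noteq> Leaf \<Longrightarrow> runs c s T Q" "eval_expr e s = Leaf \<Longrightarrow> runs d s T Q"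
  shows "runs (Cond e c d) s (expr_cost e * Suc M + T) Q"
proof (cases "eval_expr e s = Leaf")
  case True
  with assms(3) obtain t s' where "exec d s t s'" "t \<le> T" "Q s'" unfolding runs_def by blast
  then show ?thesis
    using time_expr_le[OF assms(1)] by (intro runsI[OF exec.CondFalse[OF True]]) auto
next
  case False
  with assms(2) obtain t s' where "exec c s t s'" "t \<le> T" "Q s'" unfolding runs_def by blast
  then show ?thesis
    using time_expr_le[OF assms(1)] by (intro runsI[OF exec.CondTrue[OF False]]) auto
qed

lemma runs_While_False:
  assumes "\<forall>v\<in>expr_vars e. size (s v) \<le> M" "eval_expr e s = Leaf" "Q s"
  shows "runs (While e c) s (expr_cost e * Suc M) Q"
  using time_expr_le[OF assms(1)] assms by (intro runsI[OF exec.WhileFalse]) auto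

text \<open>One unfolding of the loop. The postcondition of the body is the claim about the
  remaining rounds, so the induction can be on whatever quantity suits the loop.\<close>

lemma runs_While_True:
  assumes "\<forall>v\<in>expr_vars e. size (s v) \<le> M" "eval_expr e s \<noteq> Leaf"
    and "runs c s T (\<lambda>s'. (\<forall>v. v \<notin> writes c \<longrightarrow> s' v = s v) \<longrightarrow> runs (While e c) s' U Q)"
  shows "runs (While e c) s (expr_cost e * Suc M + T + U) Q"
proof -
  obtain t s' where 1: "exec c s t s'" "t \<le> T" "runs (While e c) s' U Q"
    using assms(3) unfolding runs_def by blast
  obtain u s'' where 2: "exec (While e c) s' u s''" "u \<le> U" "Q s''"
    using 1(3) unfolding runs_def by blast
  show ?thesis
    using time_expr_le[OF assms(1)] 1 2
    by (intro runsI[OF exec.WhileTrue[OF assms(2) 1(1) 2(1)]]) auto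
qed

lemma runs_frame: "runs c s T Q \<Longrightarrow> runs c s T (\<lambda>s'. Q s' \<and> (\<forall>v. v \<notin> writes c \<longrightarrow> s' v = s v))"
  unfolding runs_def by blast

section \<open>Encoded lists and loops over them\<close>

lemma size_enc_list_append:
  "size (enc_list f (xs @ ys)) = size (enc_list f xs) + size (enc_list f ys)"
  by (induction xs) auto

lemma length_le_size_enc_list: "length xs \<le> size (enc_list f xs)"
  by (induction xs) auto

lemma size_enc_list_member: "x \<in> set xs \<Longrightarrow> size (f x) < size (enc_list f xs)"
  by (induction xs) auto

lemma size_enc_list_le:
  "(\<And>x. x \<in> set xs \<Longrightarrow> size (f x) < c) \<Longrightarrow> size (enc_list f xs) \<le> length xs * c"
proof (induction xs)
  case (Cons x xs)
  then have "size (f x) < c" "size (enc_list f xs) \<le> length xs * c" by auto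
  then show ?case by simp
qed simp

lemma size_enc_list_rev: "size (enc_list f (rev xs)) = size (enc_list f xs)"
  by (induction xs) (auto simp: size_enc_list_append)

text \<open>The loop consumes its list; while the body runs, the current element is the head of
  \<open>r\<close>.\<close>

definition foreach :: "nat \<Rightarrow> com \<Rightarrow> com" where
  "foreach r c = While (Var r) (Seq c (Assign r (Tl (Var r))))"

lemma writes_foreach: "writes (foreach r c) = insert r (writes c)"
  by (auto simp: foreach_def)

text \<open>\<open>Inv\<close> speaks of the prefix already processed. The body has to establish it
  for the store in which \<open>r\<close> is already advanced, so instances of this rule never deal
  with the assignment to \<open>r\<close>.\<close>

lemma runs_foreach:
  assumes r: "s0 r = enc_list f xs" "r \<notin> writes c" and size: "size (enc_list f xs) \<le> M"
    and init: "Inv [] s0"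
    and step: "\<And>ys x zs s. xs = ys @ x # zs \<Longrightarrow> s r = Node (f x) (enc_list f zs) \<Longrightarrow>
      size (s r) \<le> M \<Longrightarrow> Inv ys s \<Longrightarrow> \<forall>v. v \<noteq> r \<longrightarrow> v \<notin> writes c \<longrightarrow> s v = s0 v \<Longrightarrow>
      runs c s T (\<lambda>s'. Inv (ys @ [x]) (s'(r := enc_list f zs)))"
  shows "runs (foreach r c) s0 (Suc M * (T + 3 * Suc M)) (\<lambda>s'. Inv xs s' \<and> s' r = Leaf)"
proof -
  \<comment> \<open>Besides the body, a round costs \<open>Suc M\<close> for the test and
    \<open>2 * Suc M\<close> for advancing \<open>r\<close>. The last summand pays for the failing
    test.\<close>
  have "runs (foreach r c) s (length zs * (T + 3 * Suc M) + Suc M) (\<lambda>s'. Inv xs s' \<and> s' r = Leaf)"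
    if "xs = ys @ zs" "s r = enc_list f zs" "Inv ys s"
      "\<forall>v. v \<noteq> r \<longrightarrow> v \<notin> writes c \<longrightarrow> s v = s0 v" for ys zs s
    using that
  proof (induction zs arbitrary: ys s)
    case Nil
    have "runs (foreach r c) s (expr_cost (Var r) * Suc M) (\<lambda>s'. Inv xs s' \<and> s' r = Leaf)"
      unfolding foreach_def by (rule runs_While_False) (use Nil in auto)
    then show ?case by simp
  next
    case (Cons z zs)
    have szs: "size (s r) \<le> M"
      using size Cons.prems(1,2) by (simp add: size_enc_list_append)
    have body: "runs (Seq c (Assign r (Tl (Var r)))) s (T + 2 * Suc M)
      (\<lambda>s'. (\<forall>v. v \<notin> writes (Seq c (Assign r (Tl (Var r)))) \<longrightarrow> s' v = s v) \<longrightarrow>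
        runs (foreach r c) s' (length zs * (T + 3 * Suc M) + Suc M) (\<lambda>s'. Inv xs s' \<and> s' r = Leaf))"
    proof (rule runs_Seq[OF step])
      show "xs = ys @ z # zs" "s r = Node (f z) (enc_list f zs)" "Inv ys s" "size (s r) \<le> M"
        "\<forall>v. v \<noteq> r \<longrightarrow> v \<notin> writes c \<longrightarrow> s v = s0 v"
        using Cons.prems szs by auto
      fix s' assume s': "Inv (ys @ [z]) (s'(r := enc_list f zs))"
        "\<forall>v. v \<notin> writes c \<longrightarrow> s' v = s v"
      have r': "s' r = Node (f z) (enc_list f zs)" using s'(2) r(2) Cons.prems(2) by simp
      have "runs (Assign r (Tl (Var r))) s' (expr_cost (Tl (Var r)) * Suc M)
        (\<lambda>s'. (\<forall>v. v \<notin> writes (Seq c (Assign r (Tl (Var r)))) \<longrightarrow> s' v = s v) \<longrightarrow>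
          runs (foreach r c) s' (length zs * (T + 3 * Suc M) + Suc M) (\<lambda>s'. Inv xs s' \<and> s' r = Leaf))"
      proof (rule runs_Assign)
        show "\<forall>v\<in>expr_vars (Tl (Var r)). size (s' v) \<le> M"
          using szs r' Cons.prems(2) by simp
        have "runs (foreach r c) (s'(r := enc_list f zs))
                (length zs * (T + 3 * Suc M) + Suc M) (\<lambda>s'. Inv xs s' \<and> s' r = Leaf)"
        proof (rule Cons.IH)
          show "Inv (ys @ [z]) (s'(r := enc_list f zs))" by fact
        qed (use Cons.prems s'(2) in simp_all)
        then show "(\<forall>v. v \<notin> writes (Seq c (Assign r (Tl (Var r)))) \<longrightarrow>
              (s'(r := eval_expr (Tl (Var r)) s')) v = s v) \<longrightarrow>
            runs (foreach r c) (s'(r := eval_expr (Tl (Var r)) s'))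
              (length zs * (T + 3 * Suc M) + Suc M) (\<lambda>s'. Inv xs s' \<and> s' r = Leaf)"
          using r' by simp
      qed
      then show "runs (Assign r (Tl (Var r))) s' (2 * Suc M)
        (\<lambda>s'. (\<forall>v. v \<notin> writes (Seq c (Assign r (Tl (Var r)))) \<longrightarrow> s' v = s v) \<longrightarrow>
          runs (foreach r c) s' (length zs * (T + 3 * Suc M) + Suc M) (\<lambda>s'. Inv xs s' \<and> s' r = Leaf))"
        by (rule runs_weaken) simp_all
    qed
    have "runs (foreach r c) s (expr_cost (Var r) * Suc M + (T + 2 * Suc M) +
        (length zs * (T + 3 * Suc M) + Suc M)) (\<lambda>s'. Inv xs s' \<and> s' r = Leaf)"
      unfolding foreach_def
      by (rule runs_While_True[OF _ _ body[unfolded foreach_def]]) (use szs Cons.prems in auto)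
    then show ?case by (rule runs_weaken) simp_all
  qed
  from this[of "[]" xs s0]
  have main: "runs (foreach r c) s0 (length xs * (T + 3 * Suc M) + Suc M) (\<lambda>s'. Inv xs s' \<and> s' r = Leaf)"
    using r init by simp
  \<comment> \<open>There are at most \<open>M\<close> rounds, so the failing test fits into the
    budget of one further round.\<close>
  have time: "length xs * X + Suc M \<le> Suc M * X" if "Suc M \<le> X" for X
  proof -
    have "length xs \<le> M" using length_le_size_enc_list[of xs f] size by linarith
    from mult_le_mono1[OF this, of X] that show ?thesis unfolding mult_Suc by linarith
  qed
  show ?thesis by (rule runs_weaken[OF main time]) simp_all
qed

lemma fold_Node_enc_list:
  "fold (\<lambda>x. Node (f (h x))) xs (enc_list f ys) = enc_list f (rev (map h xs) @ ys)"
proof (induction xs arbitrary: ys)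
  case (Cons x xs)
  show ?case using Cons.IH[of "h x # ys"] by simp
qed simp

text \<open>Thanks to this monotonicity, a bound on the final accumulator is the only one that a
  loop with consing has to be given.\<close>

lemma size_fold_Node: "size d \<le> size (fold (\<lambda>x. Node (g x)) xs d)"
proof (induction xs arbitrary: d)
  case (Cons x xs)
  show ?case using Cons.IH[of "Node (g x) d"] by simp
qed simp

text \<open>The images are put in front of the previous contents of \<open>a\<close>, in reverse
  order. Two calls with the same \<open>a\<close> therefore concatenate, which is how the star and
  the edges of \<open>H\<close> end up in one list.\<close>

definition map_onto :: "nat \<Rightarrow> expr \<Rightarrow> expr \<Rightarrow> nat \<Rightarrow> com" where
  "map_onto r src e a = Seq (Assign r src) (foreach r (Assign a (Cons e (Var a))))"

lemma writes_map_onto: "writes (map_onto r src e a) = {r, a}"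
  by (auto simp: map_onto_def writes_foreach)

lemma runs_map_loop:
  assumes r: "s0 r = enc_list f xs" and a: "a \<noteq> r" "a \<notin> expr_vars e"
    and e: "\<And>x zs s. x \<in> set xs \<Longrightarrow> s r = Node (f x) (enc_list f zs) \<Longrightarrow>
      \<forall>v. v \<noteq> r \<longrightarrow> v \<noteq> a \<longrightarrow> s v = s0 v \<Longrightarrow> eval_expr e s = g x"
    and size: "\<forall>v\<in>expr_vars e - {r}. size (s0 v) \<le> M" "size (enc_list f xs) \<le> M"
      "size (fold (\<lambda>x. Node (g x)) xs (s0 a)) \<le> M"
  shows "runs (foreach r (Assign a (Cons e (Var a)))) s0
    ((expr_cost (Cons e (Var a)) + 3) * Suc M ^ 2)
    (\<lambda>s'. s' a = fold (\<lambda>x. Node (g x)) xs (s0 a) \<and> s' r = Leaf)"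
proof -
  let ?c = "Assign a (Cons e (Var a))"
  let ?Inv = "\<lambda>ys s. s a = fold (\<lambda>x. Node (g x)) ys (s0 a)"
  have "runs (foreach r ?c) s0 (Suc M * (expr_cost (Cons e (Var a)) * Suc M + 3 * Suc M))
      (\<lambda>s'. ?Inv xs s' \<and> s' r = Leaf)"
  proof (rule runs_foreach[where Inv = ?Inv and f = f])
    fix ys x zs s
    assume h: "xs = ys @ x # zs" "s r = Node (f x) (enc_list f zs)" "size (s r) \<le> M"
      "s a = fold (\<lambda>x. Node (g x)) ys (s0 a)" "\<forall>v. v \<noteq> r \<longrightarrow> v \<notin> writes ?c \<longrightarrow> s v = s0 v"
    have fr: "\<forall>v. v \<noteq> r \<longrightarrow> v \<noteq> a \<longrightarrow> s v = s0 v" using h(5) by simp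
    have ev: "eval_expr e s = g x" using e[OF _ h(2) fr] h(1) by simp
    have "size (s a) \<le> size (fold (\<lambda>x. Node (g x)) (x # zs) (s a))" by (rule size_fold_Node)
    also have "\<dots> \<le> M" using size(3) h(1,4) by simp
    finally have sa: "size (s a) \<le> M" .
    show "runs ?c s (expr_cost (Cons e (Var a)) * Suc M) (\<lambda>s'. ?Inv (ys @ [x]) (s'(r := enc_list f zs)))"
    proof (rule runs_Assign)
      show "\<forall>v\<in>expr_vars (Cons e (Var a)). size (s v) \<le> M"
        using sa fr size(1) a h(3) by (metis Diff_iff UnE expr_vars.simps(1,3) singletonD)
    qed (use a ev h(4) in simp)
  qed (use r a size(2) in auto)
  moreover have "Suc M * (c * Suc M + 3 * Suc M) = (c + 3) * Suc M ^ 2" for c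
    by (simp add: power2_eq_square algebra_simps)
  ultimately show ?thesis by (simp only:)
qed

lemma runs_map_onto:
  assumes src: "eval_expr src s0 = enc_list f xs" "\<forall>v\<in>expr_vars src. size (s0 v) \<le> M"
    and a: "a \<noteq> r" "a \<notin> expr_vars e"
    and e: "\<And>x zs s. x \<in> set xs \<Longrightarrow> s r = Node (f x) (enc_list f zs) \<Longrightarrow>
      \<forall>v. v \<noteq> r \<longrightarrow> v \<noteq> a \<longrightarrow> s v = s0 v \<Longrightarrow> eval_expr e s = g x"
    and size: "\<forall>v\<in>expr_vars e - {r}. size (s0 v) \<le> M" "size (enc_list f xs) \<le> M"
      "size (fold (\<lambda>x. Node (g x)) xs (s0 a)) \<le> M"
  shows "runs (map_onto r src e a) s0
    ((expr_cost src + expr_cost (Cons e (Var a)) + 3) * Suc M ^ 2)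
    (\<lambda>s'. s' a = fold (\<lambda>x. Node (g x)) xs (s0 a))"
proof -
  have main: "runs (map_onto r src e a) s0
      (expr_cost src * Suc M + (expr_cost (Cons e (Var a)) + 3) * Suc M ^ 2)
      (\<lambda>s'. s' a = fold (\<lambda>x. Node (g x)) xs (s0 a))"
    unfolding map_onto_def
  proof (rule runs_Seq)
    show "runs (Assign r src) s0 (expr_cost src * Suc M) (\<lambda>s. s = s0(r := enc_list f xs))"
      by (rule runs_Assign) (use src in auto)
    fix s assume s: "s = s0(r := enc_list f xs)"
    have "runs (foreach r (Assign a (Cons e (Var a)))) s
        ((expr_cost (Cons e (Var a)) + 3) * Suc M ^ 2)
        (\<lambda>s'. s' a = fold (\<lambda>x. Node (g x)) xs (s a) \<and> s' r = Leaf)"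
    proof (rule runs_map_loop[where f = f])
      show "eval_expr e s' = g x"
        if "x \<in> set xs" "s' r = Node (f x) (enc_list f zs)"
          "\<forall>v. v \<noteq> r \<longrightarrow> v \<noteq> a \<longrightarrow> s' v = s v" for x zs s'
        using e[of x s' zs] that s by simp
    qed (use s a size in auto)
    then show "runs (foreach r (Assign a (Cons e (Var a)))) s
        ((expr_cost (Cons e (Var a)) + 3) * Suc M ^ 2)
        (\<lambda>s'. s' a = fold (\<lambda>x. Node (g x)) xs (s0 a))"
      by (rule runs_weaken) (use s a in auto)
  qed
  have time: "c * Suc M + (d + 3) * Suc M ^ 2 \<le> (c + d + 3) * Suc M ^ 2" for c d
    by (simp add: power2_eq_square algebra_simps)
  show ?thesis by (rule runs_weaken[OF main time])
qed

section \<open>Arithmetic on binary numbers\<close>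

lemma enc_nat_0: "enc_nat 0 = Leaf"
  by (simp add: enc_nat.simps)

lemma enc_nat_pos: "0 < n \<Longrightarrow> enc_nat n = Node (enc_bool (odd n)) (enc_nat (n div 2))"
  by (simp add: enc_nat.simps)

lemma enc_nat_1: "enc_nat (Suc 0) = Node (Node Leaf Leaf) Leaf"
  by (simp add: enc_nat_pos enc_nat_0 enc_bool_def)

lemma tl_enc_nat: "tl_data (enc_nat n) = enc_nat (n div 2)"
  by (cases "n = 0") (simp_all add: enc_nat_0 enc_nat_pos)

lemma hd_enc_nat: "hd_data (enc_nat n) = enc_bool (odd n)"
  by (cases "n = 0") (simp_all add: enc_nat_0 enc_nat_pos enc_bool_def)

lemma enc_bool_inject: "enc_bool a = enc_bool b \<longleftrightarrow> a = b"
  by (simp add: enc_bool_def)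

lemma enc_bool_eq_Leaf: "enc_bool a = Leaf \<longleftrightarrow> \<not> a"
  by (simp add: enc_bool_def)

text \<open>Makes \<open>Eq\<close> on encodings a valid equality test for node names and
  counters.\<close>

lemma enc_nat_inject: "enc_nat m = enc_nat n \<longleftrightarrow> m = n"
proof
  show "enc_nat m = enc_nat n \<Longrightarrow> m = n"
  proof (induction m arbitrary: n rule: less_induct)
    case (less m)
    show ?case
    proof (cases "m = 0 \<or> n = 0")
      case True
      with less.prems show ?thesis by (cases "m = 0"; cases "n = 0") (simp_all add: enc_nat_0 enc_nat_pos)
    next
      case False
      with less.prems have "odd m = odd n" "enc_nat (m div 2) = enc_nat (n div 2)"
        by (simp_all add: enc_nat_pos enc_bool_inject)
      with less.IH[of "m div 2" "n div 2"] False have "m div 2 = n div 2" "odd m = odd n" by auto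
      then show ?thesis by (metis odd_two_times_div_two_succ even_two_times_div_two)
    qed
  qed
qed simp

text \<open>Far from the logarithmic truth, but it is applied only to numbers bounded by the length
  of a list.\<close>

lemma size_enc_nat: "size (enc_nat n) \<le> 2 * n"
proof (induction n rule: less_induct)
  case (less n)
  show ?case
  proof (cases "n = 0")
    case False
    then have "size (enc_nat (n div 2)) \<le> 2 * (n div 2)" by (intro less.IH) auto
    with False show ?thesis
      using size_enc_bool[of "odd n"] by (cases "even n") (auto simp: enc_nat_pos enc_bool_def elim!: evenE oddE)
  qed (simp add: enc_nat_0)
qed

text \<open>Trailing ones of the counter are moved, as zeros, to the list in \<open>a\<close>.\<close>

definition carry :: "nat \<Rightarrow> nat \<Rightarrow> com" where
  "carry x a = While (Hd (Var x))
     (Seq (Assign a (Cons (Const Leaf) (Var a))) (Assign x (Tl (Var x))))"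

text \<open>After \<open>carry\<close>, either the lowest bit is 0 or no bit is left. Replacing the
  head by 1 is right in both cases, because the tail of \<open>Leaf\<close> is \<open>Leaf\<close>;
  the stored zeros are then put back.\<close>

definition increment :: "nat \<Rightarrow> nat \<Rightarrow> com" where
  "increment x a = Seq (carry x a)
     (Seq (Assign x (Cons (Const (Node Leaf Leaf)) (Tl (Var x))))
        (foreach a (Assign x (Cons (Const Leaf) (Var x)))))"

lemma writes_increment: "writes (increment x a) = {x, a}"
  by (auto simp: increment_def carry_def writes_foreach)

abbreviation zeros :: "nat \<Rightarrow> data" where
  "zeros j \<equiv> enc_list (\<lambda>_. Leaf) (replicate j ())"

abbreviation shift :: "nat \<Rightarrow> data \<Rightarrow> data" where
  "shift j \<equiv> fold (\<lambda>_. Node Leaf) (replicate j ())"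

lemma size_zeros: "size (zeros j) = j"
  by (induction j) auto

text \<open>If \<open>n\<close> is even, its successor just sets the lowest bit. If \<open>n\<close>
  is odd, its successor is twice that of \<open>n div 2\<close>, so one more zero is stored and
  \<open>n + j\<close> does not grow. The equation between shifts says that the intended result
  stays the same throughout. The number of rounds is bounded by \<open>n\<close> instead of its
  number of bits.\<close>

lemma runs_carry:
  assumes "x \<noteq> a" "s x = enc_nat n" "s a = zeros j" "n + j \<le> L" "2 * L \<le> M"
  shows "runs (carry x a) s (Suc n * (8 * Suc M))
    (\<lambda>s'. \<exists>i m. s' a = zeros i \<and> s' x = enc_nat m \<and> m + i \<le> L \<and>
       shift i (Node (Node Leaf Leaf) (enc_nat (m div 2))) = shift j (enc_nat (Suc n)))"
    (is "runs _ _ _ (?Q j n)")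
  using assms
proof (induction n arbitrary: s j rule: less_induct)
  case (less n)
  have sz: "size (s x) \<le> M" "size (s a) \<le> M"
    using less.prems size_enc_nat[of n] size_zeros[of j] by auto
  show ?case
  proof (cases "even n")
    case True
    have "enc_nat (Suc n) = Node (Node Leaf Leaf) (enc_nat (n div 2))"
      using True by (simp add: enc_nat_pos enc_bool_def)
    then have "?Q j n s"
      using less.prems by (intro exI[of _ j] exI[of _ n]) simp
    moreover have "eval_expr (Hd (Var x)) s = Leaf"
      using less.prems(2) True by (simp add: hd_enc_nat enc_bool_def)
    ultimately have "runs (carry x a) s (expr_cost (Hd (Var x)) * Suc M) (?Q j n)"
      unfolding carry_def using sz by (intro runs_While_False) auto
    then show ?thesis by (rule runs_weaken) simp_all
  next
    case False
    then have n: "n div 2 < n" "Suc n div 2 = Suc (n div 2)" by (auto elim!: oddE)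
    have "enc_nat (Suc n) = Node Leaf (enc_nat (Suc (n div 2)))"
      using False n(2) by (simp add: enc_nat_pos enc_bool_def)
    then have eqQ: "?Q (Suc j) (n div 2) s' \<Longrightarrow> ?Q j n s'" for s' by simp
    let ?c = "Seq (Assign a (Cons (Const Leaf) (Var a))) (Assign x (Tl (Var x)))"
    have "runs ?c s (expr_cost (Cons (Const Leaf) (Var a)) * Suc M + expr_cost (Tl (Var x)) * Suc M)
        (\<lambda>s'. s' x = enc_nat (n div 2) \<and> s' a = zeros (Suc j))"
    proof (rule runs_Seq)
      show "runs (Assign a (Cons (Const Leaf) (Var a))) s (expr_cost (Cons (Const Leaf) (Var a)) * Suc M)
        (\<lambda>s'. s' = s(a := zeros (Suc j)))"
        by (rule runs_Assign) (use sz less.prems in auto)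
      show "runs (Assign x (Tl (Var x))) s' (expr_cost (Tl (Var x)) * Suc M)
        (\<lambda>s'. s' x = enc_nat (n div 2) \<and> s' a = zeros (Suc j))"
        if "s' = s(a := zeros (Suc j))" for s'
        by (rule runs_Assign) (use that sz less.prems in \<open>auto simp: tl_enc_nat\<close>)
    qed
    then have body: "runs ?c s (6 * Suc M) (\<lambda>s'. (\<forall>v. v \<notin> writes ?c \<longrightarrow> s' v = s v) \<longrightarrow>
        runs (carry x a) s' (Suc (n div 2) * (8 * Suc M)) (?Q (Suc j) (n div 2)))"
    proof (rule runs_weaken)
      fix s' assume "s' x = enc_nat (n div 2) \<and> s' a = zeros (Suc j)"
      then have "runs (carry x a) s' (Suc (n div 2) * (8 * Suc M)) (?Q (Suc j) (n div 2))"
        using less.prems n(1) by (intro less.IH) auto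
      then show "(\<forall>v. v \<notin> writes ?c \<longrightarrow> s' v = s v) \<longrightarrow>
        runs (carry x a) s' (Suc (n div 2) * (8 * Suc M)) (?Q (Suc j) (n div 2))" by blast
    qed simp
    have "runs (carry x a) s (expr_cost (Hd (Var x)) * Suc M + 6 * Suc M + Suc (n div 2) * (8 * Suc M))
        (?Q (Suc j) (n div 2))"
      unfolding carry_def
      by (rule runs_While_True[OF _ _ body[unfolded carry_def]])
        (use sz less.prems(2) False in \<open>auto simp: hd_enc_nat enc_bool_def\<close>)
    then show ?thesis
    proof (rule runs_weaken)
      have "Suc (Suc (n div 2)) * (8 * Suc M) \<le> Suc n * (8 * Suc M)"
        using n(1) by (intro mult_le_mono1) simp
      then show "expr_cost (Hd (Var x)) * Suc M + 6 * Suc M + Suc (n div 2) * (8 * Suc M)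
        \<le> Suc n * (8 * Suc M)" by simp
    qed (rule eqQ)
  qed
qed

lemma runs_increment:
  assumes "x \<noteq> a" "s x = enc_nat n" "s a = Leaf" "3 * n + 3 \<le> M"
  shows "runs (increment x a) s (22 * Suc M ^ 2) (\<lambda>s'. s' x = enc_nat (Suc n) \<and> s' a = Leaf)"
proof -
  let ?P = "\<lambda>s'. \<exists>i m. s' a = zeros i \<and> s' x = enc_nat m \<and> m + i \<le> n \<and>
       shift i (Node (Node Leaf Leaf) (enc_nat (m div 2))) = shift 0 (enc_nat (Suc n))"
  let ?e = "Cons (Const (Node Leaf Leaf)) (Tl (Var x))"
  let ?c = "Assign x (Cons (Const Leaf) (Var x))"
  let ?R = "\<lambda>s'. \<exists>i. s' a = zeros i \<and> i \<le> n \<and> shift i (s' x) = enc_nat (Suc n)"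
  let ?U = "(expr_cost (Cons (Const Leaf) (Var x)) + 3) * Suc M ^ 2"
  have 1: "runs (carry x a) s (Suc n * (8 * Suc M)) ?P"
    by (rule runs_carry) (use assms in auto)
  have 2: "runs (Assign x ?e) s1 (expr_cost ?e * Suc M) ?R" if "?P s1" for s1
  proof -
    obtain i m where im: "s1 a = zeros i" "s1 x = enc_nat m" "m + i \<le> n"
      "shift i (Node (Node Leaf Leaf) (enc_nat (m div 2))) = enc_nat (Suc n)" using \<open>?P s1\<close> by auto
    show ?thesis
    proof (rule runs_Assign)
      show "\<forall>v\<in>expr_vars ?e. size (s1 v) \<le> M" using im assms(4) size_enc_nat[of m] by simp
      show "?R (s1(x := eval_expr ?e s1))"
        using im assms(1) by (intro exI[of _ i]) (simp add: tl_enc_nat)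
    qed
  qed
  have 3: "runs (foreach a ?c) s2 ?U (\<lambda>s'. s' x = enc_nat (Suc n) \<and> s' a = Leaf)" if R: "?R s2" for s2
  proof -
    obtain i where i: "s2 a = zeros i" "i \<le> n" "shift i (s2 x) = enc_nat (Suc n)" using R by blast
    have "size (shift i (s2 x)) \<le> M"
      unfolding i(3) using size_enc_nat[of "Suc n"] assms(4) by simp
    then have "runs (foreach a ?c) s2 ?U (\<lambda>s'. s' x = shift i (s2 x) \<and> s' a = Leaf)"
      using i assms by (intro runs_map_loop[where f = "\<lambda>_. Leaf"]) (auto simp: size_zeros)
    then show ?thesis using i(3) by simp
  qed
  have "runs (increment x a) s (Suc n * (8 * Suc M) + (expr_cost ?e * Suc M + ?U))
      (\<lambda>s'. s' x = enc_nat (Suc n) \<and> s' a = Leaf)"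
    unfolding increment_def by (rule runs_Seq[OF 1 runs_Seq[OF 2 3]])
  then show ?thesis
  proof (rule runs_weaken)
    \<comment> \<open>The constant 22 is 8 for the carry, 7 for setting the bit and 7 for putting
      back the zeros.\<close>
    have "Suc n * (8 * K) + (7 * K + 7 * K ^ 2) \<le> 22 * K ^ 2" if "Suc n \<le> K" for K
      using mult_le_mono1[OF that, of "8 * K"] le_square[of K] unfolding power2_eq_square by linarith
    from this[of "Suc M"] assms(4) show "Suc n * (8 * Suc M) + (expr_cost ?e * Suc M + ?U) \<le> 22 * Suc M ^ 2"
      by (simp del: mult_Suc mult_Suc_right power_Suc)
  qed
qed

text \<open>The list is counted in \<open>j\<close> until \<open>k\<close> is reached and in \<open>d\<close> from then on, so that binary
  subtraction is replaced by incrementing.\<close>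

definition subtract_length :: "nat \<Rightarrow> nat \<Rightarrow> nat \<Rightarrow> nat \<Rightarrow> nat \<Rightarrow> com" where
  "subtract_length r k j d a =
     foreach r (Cond (Eq (Var j) (Var k)) (increment d a) (increment j a))"

lemma writes_subtract_length: "writes (subtract_length r k j d a) = {r, j, d, a}"
  by (auto simp: subtract_length_def writes_foreach writes_increment)

lemma runs_subtract_length:
  assumes reg: "distinct [r, k, j, d, a]"
    and s: "s0 r = enc_list f xs" "s0 k = enc_nat n" "s0 j = Leaf" "s0 d = Leaf" "s0 a = Leaf"
    and n: "n \<le> length xs" and size: "size (enc_list f xs) \<le> M" "3 * length xs + 3 \<le> M"
  shows "runs (subtract_length r k j d a) s0 (29 * Suc M ^ 3)
    (\<lambda>s'. s' d = enc_nat (length xs - n))"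
proof -
  \<comment> \<open>\<open>min\<close> and truncated subtraction describe the phases before and
    after reaching \<open>n\<close> by one invariant.\<close>
  let ?Inv = "\<lambda>ys s. s j = enc_nat (min n (length ys)) \<and> s d = enc_nat (length ys - n) \<and> s a = Leaf"
  let ?test = "Eq (Var j) (Var k)"
  let ?c = "Cond ?test (increment d a) (increment j a)"
  have "runs (subtract_length r k j d a) s0
      (Suc M * (expr_cost ?test * Suc M + 22 * Suc M ^ 2 + 3 * Suc M))
      (\<lambda>s'. ?Inv xs s' \<and> s' r = Leaf)"
    unfolding subtract_length_def
  proof (rule runs_foreach[where Inv = ?Inv and f = f])
    show "r \<notin> writes ?c" using reg by (auto simp: writes_increment)
    show "?Inv [] s0" using s by (simp add: enc_nat_0)
    fix ys x zs s
    assume h: "xs = ys @ x # zs" "?Inv ys s" "\<forall>v. v \<noteq> r \<longrightarrow> v \<notin> writes ?c \<longrightarrow> s v = s0 v"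
    have k: "s k = enc_nat n" using h(3) reg s by (auto simp: writes_increment)
    have len: "length ys < length xs" using h(1) by simp
    have sz: "size (enc_nat (min n (length ys))) \<le> M" "size (enc_nat n) \<le> M"
      using size_enc_nat[of "min n (length ys)"] size_enc_nat[of n] n len size(2) by linarith+
    have test: "eval_expr ?test s = enc_bool (n \<le> length ys)"
      using h(2) k by (simp add: enc_nat_inject min_def)
    show "runs ?c s (expr_cost ?test * Suc M + 22 * Suc M ^ 2)
        (\<lambda>s'. ?Inv (ys @ [x]) (s'(r := enc_list f zs)))"
    proof (rule runs_Cond)
      show "\<forall>v\<in>expr_vars ?test. size (s v) \<le> M" using h(2) k sz by simp
    next
      assume "eval_expr ?test s \<noteq> Leaf"
      then have le: "n \<le> length ys" unfolding test enc_bool_eq_Leaf by simp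
      have "runs (increment d a) s (22 * Suc M ^ 2)
          (\<lambda>s'. s' d = enc_nat (Suc (length ys - n)) \<and> s' a = Leaf)"
        by (rule runs_increment) (use reg h len size(2) in auto)
      from runs_frame[OF this]
      show "runs (increment d a) s (22 * Suc M ^ 2) (\<lambda>s'. ?Inv (ys @ [x]) (s'(r := enc_list f zs)))"
        by (rule runs_weaken) (use reg h(2) le in \<open>auto simp: writes_increment Suc_diff_le\<close>)
    next
      assume "eval_expr ?test s = Leaf"
      then have "length ys < n" unfolding test enc_bool_eq_Leaf by simp
      then have le: "min n (length ys) = length ys" "min n (Suc (length ys)) = Suc (length ys)"
        "length ys - n = 0" "Suc (length ys) - n = 0" by auto
      have "runs (increment j a) s (22 * Suc M ^ 2)
          (\<lambda>s'. s' j = enc_nat (Suc (min n (length ys))) \<and> s' a = Leaf)"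
        by (rule runs_increment) (use reg h len size(2) in auto)
      from runs_frame[OF this]
      show "runs (increment j a) s (22 * Suc M ^ 2) (\<lambda>s'. ?Inv (ys @ [x]) (s'(r := enc_list f zs)))"
        by (rule runs_weaken) (use reg h(2) le in \<open>auto simp: writes_increment\<close>)
    qed
  qed (use s size in auto)
  then show ?thesis
  proof (rule runs_weaken)
    have "K * (4 * K + 22 * K ^ 2 + 3 * K) \<le> 29 * K ^ 3" for K :: nat
      using mult_le_mono2[OF le_square[of K], of K]
      by (simp add: power2_eq_square power3_eq_cube algebra_simps)
    moreover have cost: "expr_cost ?test = 4" by simp
    ultimately
    show "Suc M * (expr_cost ?test * Suc M + 22 * Suc M ^ 2 + 3 * Suc M) \<le> 29 * Suc M ^ 3"
      unfolding cost by blast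
  qed auto
qed

text \<open>The bit of an edge is set if the edge was removed, so endpoints are collected where it
  is not. Repetitions are harmless, as only membership is asked for later. The edges of
  \<open>H\<close> run out before the bits of the star edges are reached.\<close>

definition collect_ends :: "nat \<Rightarrow> nat \<Rightarrow> nat \<Rightarrow> com" where
  "collect_ends r b a = foreach r
     (Seq (Cond (Hd (Var b)) Skip
             (Assign a (Cons (Hd (Hd (Var r))) (Cons (Tl (Hd (Var r))) (Var a)))))
          (Assign b (Tl (Var b))))"

lemma writes_collect_ends: "writes (collect_ends r b a) = {r, b, a}"
  by (auto simp: collect_ends_def writes_foreach)

lemma runs_collect_ends:
  fixes xs :: "(nat \<times> nat) list"
  assumes reg: "distinct [r, b, a]"
    and s: "s0 r = enc_list (enc_pair enc_nat enc_nat) xs" "s0 b = enc_list enc_bool bs" "s0 a = Leaf"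
    and len: "length xs \<le> length bs"
    and size: "size (enc_list (enc_pair enc_nat enc_nat) xs) \<le> M" "size (enc_list enc_bool bs) \<le> M"
  shows "runs (collect_ends r b a) s0 (19 * Suc M ^ 2)
    (\<lambda>s'. \<exists>ns. s' a = enc_list enc_nat ns \<and>
       set ns = (\<Union>i\<in>{i. i < length xs \<and> \<not> bs ! i}. {fst (xs ! i), snd (xs ! i)}) \<and>
       size (s' a) \<le> M)"
proof -
  let ?E = "enc_list (enc_pair enc_nat enc_nat)"
  let ?N = "\<lambda>n. \<Union>i\<in>{i. i < n \<and> \<not> bs ! i}. {fst (xs ! i), snd (xs ! i)}"
  \<comment> \<open>The size bound is tight for a surviving edge: a pair in one list cell has as
    many nodes as two list cells holding its components.\<close>
  let ?Inv = "\<lambda>ys s. s b = enc_list enc_bool (drop (length ys) bs) \<and>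
    (\<exists>ns. s a = enc_list enc_nat ns \<and> set ns = ?N (length ys) \<and>
       size (enc_list enc_nat ns) \<le> size (?E ys))"
  let ?e = "Cons (Hd (Hd (Var r))) (Cons (Tl (Hd (Var r))) (Var a))"
  let ?cond = "Cond (Hd (Var b)) Skip (Assign a ?e)"
  let ?c = "Seq ?cond (Assign b (Tl (Var b)))"
  let ?T = "expr_cost (Hd (Var b)) * Suc M + 12 * Suc M + expr_cost (Tl (Var b)) * Suc M"
  have "runs (collect_ends r b a) s0 (Suc M * (?T + 3 * Suc M)) (\<lambda>s'. ?Inv xs s' \<and> s' r = Leaf)"
    unfolding collect_ends_def
  proof (rule runs_foreach[where Inv = ?Inv and f = "enc_pair enc_nat enc_nat"])
    fix ys x zs s
    assume h: "xs = ys @ x # zs" "s r = Node (enc_pair enc_nat enc_nat x) (?E zs)"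
      "size (s r) \<le> M" "?Inv ys s"
    obtain u v where x: "x = (u, v)" by (cases x)
    let ?n = "length ys"
    from h(4) obtain ns where ns: "s a = enc_list enc_nat ns" "set ns = ?N ?n"
      "size (enc_list enc_nat ns) \<le> size (?E ys)" by blast
    have lt: "?n < length bs" using len h(1) by simp
    have sb: "s b = Node (enc_bool (bs ! ?n)) (enc_list enc_bool (drop (Suc ?n) bs))"
      using h(4) lt by (simp flip: Cons_nth_drop_Suc)
    have "size (enc_list enc_bool (drop ?n bs)) \<le> M"
      using size(2) size_enc_list_append[of enc_bool "take ?n bs" "drop ?n bs"] by simp
    with h(4) have szb: "size (s b) \<le> M" by simp
    have sza: "size (s a) \<le> M"
      using ns(1,3) size(1) h(1) by (simp add: size_enc_list_append)
    have xn: "xs ! ?n = (u, v)" using h(1) x by simp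
    let ?P = "\<lambda>s'. \<exists>ns. s' a = enc_list enc_nat ns \<and> set ns = ?N (Suc ?n) \<and>
       size (enc_list enc_nat ns) \<le> size (?E (ys @ [x]))"
    have Suc_eq: "{i. i < Suc ?n \<and> \<not> bs ! i} =
        (if bs ! ?n then {i. i < ?n \<and> \<not> bs ! i} else insert ?n {i. i < ?n \<and> \<not> bs ! i})"
      by (auto simp: less_Suc_eq)
    have 1: "runs ?cond s (expr_cost (Hd (Var b)) * Suc M + 12 * Suc M) ?P"
    proof (rule runs_Cond)
      show "\<forall>v\<in>expr_vars (Hd (Var b)). size (s v) \<le> M" using szb by simp
    next
      assume "eval_expr (Hd (Var b)) s \<noteq> Leaf"
      then have "bs ! ?n" using sb by (simp add: enc_bool_eq_Leaf)
      then have "?P s" using ns by (intro exI[of _ ns]) (simp add: Suc_eq size_enc_list_append)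
      then show "runs Skip s (12 * Suc M) ?P" by (intro runs_Skip) simp_all
    next
      assume "eval_expr (Hd (Var b)) s = Leaf"
      then have b: "\<not> bs ! ?n" using sb by (simp add: enc_bool_eq_Leaf)
      have "runs (Assign a ?e) s (expr_cost ?e * Suc M) ?P"
      proof (rule runs_Assign)
        show "\<forall>v\<in>expr_vars ?e. size (s v) \<le> M" using sza h(3) by simp
        show "?P (s(a := eval_expr ?e s))"
          using ns b h(2) x xn
          by (intro exI[of _ "u # v # ns"]) (simp add: Suc_eq size_enc_list_append enc_pair_def)
      qed
      then show "runs (Assign a ?e) s (12 * Suc M) ?P" by (rule runs_weaken) simp_all
    qed
    show "runs ?c s ?T (\<lambda>s'. ?Inv (ys @ [x]) (s'(r := ?E zs)))"
    proof (rule runs_Seq[OF 1])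
      fix s' assume s': "?P s'" "\<forall>v. v \<notin> writes ?cond \<longrightarrow> s' v = s v"
      have b': "s' b = s b" using s'(2) reg by auto
      show "runs (Assign b (Tl (Var b))) s' (expr_cost (Tl (Var b)) * Suc M)
        (\<lambda>s'. ?Inv (ys @ [x]) (s'(r := ?E zs)))"
        by (rule runs_Assign) (use b' szb sb s'(1) reg in auto)
    qed
  qed (use reg s size in auto)
  then show ?thesis
  proof (rule runs_weaken)
    show "Suc M * (?T + 3 * Suc M) \<le> 19 * Suc M ^ 2"
      by (simp add: power2_eq_square algebra_simps)
  qed (use size in auto)
qed

text \<open>The element searched for is the head of \<open>x\<close>, since
  \<open>mark_members\<close> passes the register of its own loop. \<open>z\<close> is a flag
  expected to start as \<open>Leaf\<close>.\<close>

definition member_loop :: "nat \<Rightarrow> nat \<Rightarrow> nat \<Rightarrow> com" where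
  "member_loop y x z = foreach y
     (Cond (Eq (Hd (Var y)) (Hd (Var x))) (Assign z (Const (Node Leaf Leaf))) Skip)"

lemma writes_member_loop: "writes (member_loop y x z) = {y, z}"
  by (auto simp: member_loop_def writes_foreach)

lemma runs_member_loop:
  assumes reg: "distinct [y, x, z]"
    and s: "s0 y = enc_list enc_nat ns" "hd_data (s0 x) = enc_nat v" "s0 z = Leaf"
    and size: "size (s0 y) \<le> M" "size (s0 x) \<le> M"
  shows "runs (member_loop y x z) s0 (11 * Suc M ^ 2) (\<lambda>s'. s' z = enc_bool (v \<in> set ns))"
proof -
  let ?e = "Eq (Hd (Var y)) (Hd (Var x))"
  let ?c = "Cond ?e (Assign z (Const (Node Leaf Leaf))) Skip"
  let ?Inv = "\<lambda>ys s. s z = enc_bool (v \<in> set ys)"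
  have "runs (member_loop y x z) s0 (Suc M * (expr_cost ?e * Suc M + 2 * Suc M + 3 * Suc M))
      (\<lambda>s'. ?Inv ns s' \<and> s' y = Leaf)"
    unfolding member_loop_def
  proof (rule runs_foreach[where Inv = ?Inv and f = enc_nat])
    fix ys n zs s'
    assume h: "s' y = Node (enc_nat n) (enc_list enc_nat zs)" "size (s' y) \<le> M" "?Inv ys s'"
      "\<forall>v. v \<noteq> y \<longrightarrow> v \<notin> writes ?c \<longrightarrow> s' v = s0 v"
    have x: "s' x = s0 x" using h(4) reg by auto
    have ev: "eval_expr ?e s' = enc_bool (n = v)"
      using h(1) s(2) x by (simp add: enc_nat_inject)
    show "runs ?c s' (expr_cost ?e * Suc M + 2 * Suc M)
        (\<lambda>s'. ?Inv (ys @ [n]) (s'(y := enc_list enc_nat zs)))"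
    proof (rule runs_Cond)
      show "\<forall>v\<in>expr_vars ?e. size (s' v) \<le> M" using h(2) x size by simp
    next
      assume "eval_expr ?e s' \<noteq> Leaf"
      then have n: "n = v" unfolding ev enc_bool_eq_Leaf by simp
      have "runs (Assign z (Const (Node Leaf Leaf))) s'
          (expr_cost (Const (Node Leaf Leaf)) * Suc M)
          (\<lambda>s'. ?Inv (ys @ [n]) (s'(y := enc_list enc_nat zs)))"
        by (rule runs_Assign) (use n reg in \<open>auto simp: enc_bool_def\<close>)
      then show "runs (Assign z (Const (Node Leaf Leaf))) s' (2 * Suc M)
          (\<lambda>s'. ?Inv (ys @ [n]) (s'(y := enc_list enc_nat zs)))"
        by (rule runs_weaken) simp_all
    next
      assume "eval_expr ?e s' = Leaf"
      then have n: "n \<noteq> v" unfolding ev enc_bool_eq_Leaf by simp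
      show "runs Skip s' (2 * Suc M) (\<lambda>s'. ?Inv (ys @ [n]) (s'(y := enc_list enc_nat zs)))"
        by (rule runs_Skip) (use n reg h(3) in auto)
    qed
  qed (use reg s size in \<open>auto simp: enc_bool_def\<close>)
  then show ?thesis
  proof (rule runs_weaken)
    show "Suc M * (expr_cost ?e * Suc M + 2 * Suc M + 3 * Suc M) \<le> 11 * Suc M ^ 2"
      by (simp add: power2_eq_square algebra_simps)
  qed auto
qed

text \<open>The inner loop consumes its list, hence the fresh copy of \<open>l\<close> in every
  round. Consing reverses the order, so a reversed node list yields the bits in the order of the
  nodes.\<close>

definition mark_members :: "nat \<Rightarrow> nat \<Rightarrow> nat \<Rightarrow> nat \<Rightarrow> nat \<Rightarrow> com" where
  "mark_members r l y z out = foreach r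
     (Seq (Assign z (Const Leaf)) (Seq (Assign y (Var l)) (Seq (member_loop y r z)
        (Assign out (Cons (Var z) (Var out))))))"

lemma size_enc_list_bool: "size (enc_list enc_bool bs) \<le> 2 * length bs"
proof -
  have "size (enc_list enc_bool bs) \<le> length bs * 2"
    by (rule size_enc_list_le) (simp add: enc_bool_def)
  then show ?thesis by simp
qed

lemma runs_mark_members:
  assumes reg: "distinct [r, l, y, z, out]"
    and s: "s0 r = enc_list enc_nat xs" "s0 l = enc_list enc_nat ns" "s0 out = Leaf"
    and size: "size (s0 r) \<le> M" "size (s0 l) \<le> M" "2 * length xs \<le> M" "1 \<le> M"
  shows "runs (mark_members r l y z out) s0 (20 * Suc M ^ 3)
    (\<lambda>s'. s' out = enc_list enc_bool (map (\<lambda>v. v \<in> set ns) (rev xs)))"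
proof -
  let ?P = "\<lambda>v. v \<in> set ns"
  let ?Inv = "\<lambda>ys s. s out = enc_list enc_bool (map ?P (rev ys))"
  let ?c4 = "Assign out (Cons (Var z) (Var out))"
  let ?c3 = "Seq (member_loop y r z) ?c4"
  let ?c2 = "Seq (Assign y (Var l)) ?c3"
  let ?c = "Seq (Assign z (Const Leaf)) ?c2"
  let ?T = "expr_cost (Const Leaf) * Suc M + (expr_cost (Var l) * Suc M +
    (11 * Suc M ^ 2 + expr_cost (Cons (Var z) (Var out)) * Suc M))"
  have "runs (mark_members r l y z out) s0 (Suc M * (?T + 3 * Suc M))
      (\<lambda>s'. ?Inv xs s' \<and> s' r = Leaf)"
    unfolding mark_members_def
  proof (rule runs_foreach[where Inv = ?Inv and f = enc_nat])
    show "r \<notin> writes ?c" using reg by (auto simp: writes_member_loop)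
    fix ys v zs s
    assume h: "xs = ys @ v # zs" "s r = Node (enc_nat v) (enc_list enc_nat zs)"
      "size (s r) \<le> M" "?Inv ys s" "\<forall>v. v \<noteq> r \<longrightarrow> v \<notin> writes ?c \<longrightarrow> s v = s0 v"
    have l: "s l = enc_list enc_nat ns" "size (s l) \<le> M"
      using h(5) reg s(2) size(2) by (auto simp: writes_member_loop)
    have szo: "size (s out) \<le> M"
      using h(1,4) size_enc_list_bool[of "map ?P (rev ys)"] size(3) by simp
    show "runs ?c s ?T (\<lambda>s'. ?Inv (ys @ [v]) (s'(r := enc_list enc_nat zs)))"
    proof (rule runs_Seq)
      show "runs (Assign z (Const Leaf)) s (expr_cost (Const Leaf) * Suc M) (\<lambda>s1. s1 = s(z := Leaf))"
        by (rule runs_Assign) auto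
      fix s1 assume s1: "s1 = s(z := Leaf)"
      show "runs ?c2 s1 (expr_cost (Var l) * Suc M +
          (11 * Suc M ^ 2 + expr_cost (Cons (Var z) (Var out)) * Suc M))
          (\<lambda>s'. ?Inv (ys @ [v]) (s'(r := enc_list enc_nat zs)))"
      proof (rule runs_Seq)
        show "runs (Assign y (Var l)) s1 (expr_cost (Var l) * Suc M)
            (\<lambda>s2. s2 = s1(y := enc_list enc_nat ns))"
          by (rule runs_Assign) (use s1 l reg in auto)
        fix s2 assume s2: "s2 = s1(y := enc_list enc_nat ns)"
        show "runs ?c3 s2 (11 * Suc M ^ 2 + expr_cost (Cons (Var z) (Var out)) * Suc M)
            (\<lambda>s'. ?Inv (ys @ [v]) (s'(r := enc_list enc_nat zs)))"
        proof (rule runs_Seq)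
          show "runs (member_loop y r z) s2 (11 * Suc M ^ 2) (\<lambda>s3. s3 z = enc_bool (?P v))"
            by (rule runs_member_loop) (use s1 s2 l h(2,3) reg in auto)
          fix s3 assume s3: "s3 z = enc_bool (?P v)"
            "\<forall>v. v \<notin> writes (member_loop y r z) \<longrightarrow> s3 v = s2 v"
          have out: "s3 out = s out" using s3(2) s2 s1 reg by (auto simp: writes_member_loop)
          show "runs ?c4 s3 (expr_cost (Cons (Var z) (Var out)) * Suc M)
              (\<lambda>s'. ?Inv (ys @ [v]) (s'(r := enc_list enc_nat zs)))"
          proof (rule runs_Assign)
            show "\<forall>v\<in>expr_vars (Cons (Var z) (Var out)). size (s3 v) \<le> M"
              using s3(1) out szo size_enc_bool[of "?P v"] size(4) by simp
          qed (use s3(1) out h(4) reg in auto)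
        qed
      qed
    qed
  qed (use s size in auto)
  then show ?thesis
  proof (rule runs_weaken)
    have "K * (1 * K + (1 * K + (11 * K ^ 2 + 4 * K)) + 3 * K) \<le> 20 * K ^ 3" for K :: nat
      using mult_le_mono2[OF le_square[of K], of K]
      by (simp add: power2_eq_square power3_eq_cube algebra_simps)
    moreover have cost: "expr_cost (Const Leaf) = 1" "expr_cost (Var l) = 1"
      "expr_cost (Cons (Var z) (Var out)) = 4" by simp_all
    ultimately show "Suc M * (?T + 3 * Suc M) \<le> 20 * Suc M ^ 3" unfolding cost by blast
  qed auto
qed

section \<open>The reduction as a program\<close>

abbreviation enc_edge :: "nat \<times> nat \<times> rat \<times> rat \<Rightarrow> data" where
  "enc_edge \<equiv> enc_pair enc_nat (enc_pair enc_nat (enc_pair enc_rat enc_rat))"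

lemma enc_rat_of_nat: "enc_rat (of_nat n) = Node (enc_nat n) (enc_nat 1)"
  by (simp add: enc_rat_def enc_pair_def)

lemma enc_rat_0: "enc_rat 0 = Node Leaf (enc_nat 1)"
  using enc_rat_of_nat[of 0] by (simp add: enc_nat_0)

lemma enc_rat_1: "enc_rat 1 = Node (enc_nat 1) (enc_nat 1)"
  using enc_rat_of_nat[of 1] by simp

lemma enc_nat_double_plus_1: "enc_nat (2 * n + 1) = Node (Node Leaf Leaf) (enc_nat n)"
  by (simp add: enc_nat_pos enc_bool_def)

text \<open>The cost \<open>2 b + 1\<close> of the star edges is obtained from the budget \<open>b\<close> by prefixing the bit 1.\<close>

definition star_expr :: "nat \<Rightarrow> expr" where
  "star_expr q = Cons (Hd (Hd (Var 0))) (Cons (Hd (Var (q + 2)))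
     (Cons (Const (enc_rat 0))
       (Cons (Cons (Const (Node Leaf Leaf)) (Var (q + 7))) (Const (enc_nat 1)))))"

definition edge_expr :: "nat \<Rightarrow> expr" where
  "edge_expr q = Cons (Hd (Hd (Var (q + 2)))) (Cons (Tl (Hd (Var (q + 2))))
     (Const (Node (enc_rat 1) (enc_rat 1))))"

text \<open>The registers above \<open>q\<close> are not used by the interdiction algorithm that runs between
  \<open>build_mst\<close> and \<open>extract_nodes\<close>: \<open>q + 2\<close> is the loop variable, \<open>q + 3\<close> and \<open>q + 4\<close> keep the
  reversed node and edge lists of the input, \<open>q + 7\<close> receives the budget and \<open>q + 9\<close> the edge list
  of the interdiction instance. Lists are reversed because they are built by consing.\<close>

definition build_mst :: "nat \<Rightarrow> com" where
  "build_mst q =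
     Seq (map_onto (q + 2) (Hd (Var 0)) (Hd (Var (q + 2))) (q + 3))
    (Seq (map_onto (q + 2) (Hd (Tl (Var 0))) (Hd (Var (q + 2))) (q + 4))
    (Seq (Assign (q + 2) (Var (q + 4)))
    (Seq (Assign (q + 5) (Tl (Tl (Var 0))))
    (Seq (subtract_length (q + 2) (q + 5) (q + 6) (q + 7) (q + 8))
    (Seq (map_onto (q + 2) (Tl (Hd (Var 0))) (star_expr q) (q + 9))
    (Seq (map_onto (q + 2) (Hd (Tl (Var 0))) (edge_expr q) (q + 9))
         (Assign 0 (Cons (Hd (Var 0)) (Cons (Var (q + 9)) (Cons (Var (q + 7)) (Const (enc_nat 1))))))))))))"

definition extract_nodes :: "nat \<Rightarrow> com" where
  "extract_nodes q =
     Seq (collect_ends (q + 4) 0 (q + 10))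
    (Seq (Assign 0 (Const Leaf))
         (mark_members (q + 3) (q + 10) (q + 11) (q + 12) 0))"

lemma writes_build_mst: "writes (build_mst q) \<subseteq> {0} \<union> {q + 2..q + 9}"
  by (auto simp: build_mst_def writes_map_onto writes_subtract_length)

context dks
begin

section \<open>Size of the constructed instance\<close>

abbreviation "b \<equiv> m - dks_k H"
abbreviation "enc_nodes \<equiv> enc_list enc_nat (dks_nodes H)"
abbreviation "enc_edges \<equiv> enc_list (enc_pair enc_nat enc_nat) (dks_edges H)"
abbreviation "star_tuple v \<equiv> (hd (dks_nodes H), v, 0::rat, of_nat (2 * b + 1) :: rat)"
abbreviation "edge_tuple \<equiv> \<lambda>(u, v). (u, v, 1::rat, 1::rat)"
abbreviation "star_list \<equiv> rev (map star_tuple (tl (dks_nodes H)))"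
abbreviation "N \<equiv> size (enc_dks_instance H)"

lemma input_sizes:
  "size enc_nodes \<le> N" "size enc_edges \<le> N" "size (enc_nat (dks_k H)) \<le> N"
  "length (dks_nodes H) \<le> N" "2 * m \<le> N" "size (enc_nat b) \<le> N"
proof -
  show 1: "size enc_nodes \<le> N" "size enc_edges \<le> N" "size (enc_nat (dks_k H)) \<le> N"
    by (simp_all add: enc_dks_instance_def)
  show "length (dks_nodes H) \<le> N" using length_le_size_enc_list[of "dks_nodes H" enc_nat] 1 by simp
  \<comment> \<open>Each listed edge contributes a list cell and a pair.\<close>
  have "2 * length xs \<le> size (enc_list (enc_pair enc_nat enc_nat) xs)" for xs :: "(nat \<times> nat) list"
    by (induction xs) (auto simp: enc_pair_def)
  then show 2: "2 * m \<le> N" using 1(2) order_trans by blast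
  show "size (enc_nat b) \<le> N" using size_enc_nat[of b] 2 by simp
qed

lemma mst_edges_I: "mst_edges I = rev (map edge_tuple (dks_edges H)) @ star_list"
  by (simp add: dks_to_mst_def Let_def)

lemma enc_star: "enc_edge (star_tuple v) =
    Node (enc_nat (hd (dks_nodes H))) (Node (enc_nat v) (Node (enc_rat 0)
      (Node (Node (Node Leaf Leaf) (enc_nat b)) (enc_nat 1))))"
  by (simp only: enc_pair_def prod.case enc_rat_of_nat enc_nat_double_plus_1)

lemma size_star:
  assumes "v \<in> set (tl (dks_nodes H))"
  shows "size (enc_edge (star_tuple v)) < 3 * N + 12"
proof -
  have "v \<in> set (dks_nodes H)" using assms by (meson list.set_sel(2) nodes(1))
  then have "size (enc_nat v) \<le> N" "size (enc_nat (hd (dks_nodes H))) \<le> N"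
    using size_enc_list_member[of _ "dks_nodes H" enc_nat] input_sizes(1) nodes(1)
    by (meson hd_in_set less_imp_le_nat order_trans)+
  then show ?thesis using input_sizes(6) unfolding enc_star by (simp add: enc_rat_0 enc_nat_1)
qed

lemma size_edge:
  assumes "e \<in> set (dks_edges H)"
  shows "size (enc_edge (edge_tuple e)) < N + 13"
proof -
  have "size (enc_pair enc_nat enc_nat e) < size enc_edges"
    using size_enc_list_member[OF assms] .
  then show ?thesis using input_sizes(2)
    by (cases e) (simp add: enc_pair_def enc_rat_1 enc_nat_1)
qed

lemma size_star_list: "size (enc_list enc_edge star_list) \<le> N * (3 * N + 12)"
proof -
  have "size (enc_list enc_edge star_list) \<le> length star_list * (3 * N + 12)"
    using size_star by (intro size_enc_list_le) auto
  also have "\<dots> \<le> N * (3 * N + 12)"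
    using input_sizes(4) by (intro mult_le_mono1) auto
  finally show ?thesis .
qed

lemma size_mst_edges: "size (enc_list enc_edge (mst_edges I)) \<le> N * (4 * N + 25)"
proof -
  have "size (enc_list enc_edge (rev (map edge_tuple (dks_edges H)))) \<le>
      length (rev (map edge_tuple (dks_edges H))) * (N + 13)"
    using size_edge by (intro size_enc_list_le) auto
  also have "\<dots> \<le> N * (N + 13)"
    using input_sizes(5) by (intro mult_le_mono1) auto
  finally show ?thesis using size_star_list
    unfolding mst_edges_I size_enc_list_append by (simp add: algebra_simps)
qed

lemma enc_mst_I: "enc_mst_instance I =
    Node enc_nodes (Node (enc_list enc_edge (mst_edges I)) (Node (enc_nat b) (enc_nat 1)))"
  by (simp add: enc_mst_instance_def mst_nodes_I budget_I enc_rat_of_nat)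

text \<open>One bound for the values handled by both phases of the reduction. It is quadratic
  because each star edge repeats the name of the centre and the budget, either of which may be as
  long as the input.\<close>

definition M :: nat where "M = 30 * (N + 1) ^ 2"

lemma M_bounds:
  "N \<le> M" "3 * m + 3 \<le> M" "N * (3 * N + 12) \<le> M" "N * (4 * N + 25) \<le> M"
  "size (enc_mst_instance I) \<le> M" "2 * (m + length (dks_nodes H)) \<le> M"
proof -
  have M: "M = 30 * (N * N) + 60 * N + 30" by (simp add: M_def power2_eq_square)
  show "N \<le> M" "3 * m + 3 \<le> M" "N * (3 * N + 12) \<le> M" "N * (4 * N + 25) \<le> M"
    "2 * (m + length (dks_nodes H)) \<le> M"
    unfolding M using input_sizes by (simp_all add: algebra_simps)
  show "size (enc_mst_instance I) \<le> M"
    using size_mst_edges input_sizes unfolding enc_mst_I M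
    by (simp add: enc_nat_1 algebra_simps)
qed

lemma runs_build_mst:
  "runs (build_mst q) ((\<lambda>_. Leaf)(0 := enc_dks_instance H)) (220 * Suc M ^ 3)
     (\<lambda>s. s 0 = enc_mst_instance I \<and> s (q + 3) = enc_list enc_nat (rev (dks_nodes H)) \<and>
       s (q + 4) = enc_list (enc_pair enc_nat enc_nat) (rev (dks_edges H)))"
proof -
  let ?D = "enc_dks_instance H"
  let ?rn = "enc_list enc_nat (rev (dks_nodes H))"
  let ?re = "enc_list (enc_pair enc_nat enc_nat) (rev (dks_edges H))"
  \<comment> \<open>The predicates describe the store between consecutive commands. They also record
    which registers are still \<open>Leaf\<close>, because accumulators and counters rely on
    starting empty.\<close>
  let ?P0 = "\<lambda>s. s 0 = ?D \<and> (\<forall>v>0. s v = Leaf)"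
  let ?P1 = "\<lambda>s. s 0 = ?D \<and> s (q + 3) = ?rn \<and> (\<forall>v\<ge>q + 4. s v = Leaf)"
  let ?P2 = "\<lambda>s. s 0 = ?D \<and> s (q + 3) = ?rn \<and> s (q + 4) = ?re \<and> (\<forall>v\<ge>q + 5. s v = Leaf)"
  let ?P3 = "\<lambda>s. ?P2 s \<and> s (q + 2) = ?re"
  let ?P4 = "\<lambda>s. s 0 = ?D \<and> s (q + 3) = ?rn \<and> s (q + 4) = ?re \<and> s (q + 2) = ?re \<and>
    s (q + 5) = enc_nat (dks_k H) \<and> (\<forall>v\<ge>q + 6. s v = Leaf)"
  let ?P5 = "\<lambda>e s. s 0 = ?D \<and> s (q + 3) = ?rn \<and> s (q + 4) = ?re \<and> s (q + 7) = enc_nat b \<and>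
    s (q + 9) = e"
  let ?P6 = "?P5 (enc_list enc_edge star_list)"
  let ?P7 = "?P5 (enc_list enc_edge (mst_edges I))"
  let ?P8 = "\<lambda>s. s 0 = enc_mst_instance I \<and> s (q + 3) = ?rn \<and> s (q + 4) = ?re"
  have D: "hd_data ?D = enc_nodes" "hd_data (tl_data ?D) = enc_edges"
    "tl_data (tl_data ?D) = enc_nat (dks_k H)" "size ?D \<le> M"
    using M_bounds(1) by (simp_all add: enc_dks_instance_def)
  have sz: "size enc_nodes \<le> M" "size enc_edges \<le> M" "size (enc_nat (dks_k H)) \<le> M"
    "size (enc_nat b) \<le> M"
    using input_sizes M_bounds(1) by linarith+
  have rev_fold: "fold (\<lambda>x. Node (f x)) xs Leaf = enc_list f (rev xs)" for f :: "'x \<Rightarrow> data" and xs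
    using fold_Node_enc_list[of f id xs "[]"] by simp
  let ?h = "Hd (Var (q + 2))"
  let ?T1 = "(expr_cost (Hd (Var 0)) + expr_cost (Cons ?h (Var (q + 3))) + 3) * Suc M ^ 2"
  let ?T2 = "(expr_cost (Hd (Tl (Var 0))) + expr_cost (Cons ?h (Var (q + 4))) + 3) * Suc M ^ 2"
  let ?T6 = "(expr_cost (Tl (Hd (Var 0))) + expr_cost (Cons (star_expr q) (Var (q + 9))) + 3) * Suc M ^ 2"
  let ?T7 = "(expr_cost (Hd (Tl (Var 0))) + expr_cost (Cons (edge_expr q) (Var (q + 9))) + 3) * Suc M ^ 2"
  have 1: "runs (map_onto (q + 2) (Hd (Var 0)) ?h (q + 3)) s
      ?T1 ?P1"
    if P: "?P0 s" for s
  proof -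
    have "runs (map_onto (q + 2) (Hd (Var 0)) ?h (q + 3)) s
      ?T1
      (\<lambda>s'. s' (q + 3) = fold (\<lambda>x. Node (enc_nat x)) (dks_nodes H) (s (q + 3)))"
      by (rule runs_map_onto[where f = enc_nat])
        (use P D sz in \<open>auto simp: rev_fold size_enc_list_rev\<close>)
    from runs_frame[OF this] show ?thesis
      by (rule runs_weaken) (use P in \<open>auto simp: rev_fold writes_map_onto\<close>)
  qed
  have 2: "runs (map_onto (q + 2) (Hd (Tl (Var 0))) ?h (q + 4)) s
      ?T2 ?P2"
    if P: "?P1 s" for s
  proof -
    have "runs (map_onto (q + 2) (Hd (Tl (Var 0))) ?h (q + 4)) s
      ?T2
      (\<lambda>s'. s' (q + 4) = fold (\<lambda>x. Node (enc_pair enc_nat enc_nat x)) (dks_edges H) (s (q + 4)))"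
      by (rule runs_map_onto[where f = "enc_pair enc_nat enc_nat"])
        (use P D sz in \<open>auto simp: rev_fold size_enc_list_rev\<close>)
    from runs_frame[OF this] show ?thesis
      by (rule runs_weaken) (use P in \<open>auto simp: rev_fold writes_map_onto\<close>)
  qed
  \<comment> \<open>\<open>subtract_length\<close> consumes its list, and the edges are needed again
    for decoding; it therefore gets a copy, in reversed order, which has the same length.\<close>
  have 3: "runs (Assign (q + 2) (Var (q + 4))) s (expr_cost (Var (q + 4)) * Suc M) ?P3"
    if P: "?P2 s" for s
    by (rule runs_Assign) (use P sz in \<open>auto simp: size_enc_list_rev\<close>)
  have 4: "runs (Assign (q + 5) (Tl (Tl (Var 0)))) s (expr_cost (Tl (Tl (Var 0))) * Suc M) ?P4"
    if P: "?P3 s" for s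
    by (rule runs_Assign) (use P D in auto)
  have 5: "runs (subtract_length (q + 2) (q + 5) (q + 6) (q + 7) (q + 8)) s (29 * Suc M ^ 3) (?P5 Leaf)"
    if P: "?P4 s" for s
  proof -
    have "runs (subtract_length (q + 2) (q + 5) (q + 6) (q + 7) (q + 8)) s (29 * Suc M ^ 3)
      (\<lambda>s'. s' (q + 7) = enc_nat (length (rev (dks_edges H)) - dks_k H))"
      by (rule runs_subtract_length)
        (use P k_le sz M_bounds(2) in \<open>auto simp: size_enc_list_rev\<close>)
    from runs_frame[OF this] show ?thesis
      by (rule runs_weaken) (use P in \<open>auto simp: writes_subtract_length\<close>)
  qed
  have 6: "runs (map_onto (q + 2) (Tl (Hd (Var 0))) (star_expr q) (q + 9)) s
      ?T6 ?P6"
    if P: "?P5 Leaf s" for s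
  proof -
    have fold: "fold (\<lambda>v. Node (enc_edge (star_tuple v))) (tl (dks_nodes H)) (s (q + 9)) =
        enc_list enc_edge star_list"
      using P fold_Node_enc_list[of enc_edge star_tuple "tl (dks_nodes H)" "[]"] by simp
    have tl: "tl_data enc_nodes = enc_list enc_nat (tl (dks_nodes H))"
      "hd_data enc_nodes = enc_nat (hd (dks_nodes H))"
      using nodes(1) by (cases "dks_nodes H"; simp)+
    have "runs (map_onto (q + 2) (Tl (Hd (Var 0))) (star_expr q) (q + 9)) s
      ?T6
      (\<lambda>s'. s' (q + 9) = fold (\<lambda>v. Node (enc_edge (star_tuple v))) (tl (dks_nodes H)) (s (q + 9)))"
    proof (rule runs_map_onto[where f = enc_nat])
      show "eval_expr (Tl (Hd (Var 0))) s = enc_list enc_nat (tl (dks_nodes H))"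
        using P D tl by simp
      show "\<forall>v\<in>expr_vars (star_expr q) - {q + 2}. size (s v) \<le> M"
        using P D sz by (auto simp: star_expr_def)
      show "size (enc_list enc_nat (tl (dks_nodes H))) \<le> M"
        using size_tl_data[of enc_nodes] sz(1) tl by simp
      show "size (fold (\<lambda>v. Node (enc_edge (star_tuple v))) (tl (dks_nodes H)) (s (q + 9))) \<le> M"
        unfolding fold using size_star_list M_bounds(3) by linarith
      fix x zs s'
      assume h: "s' (q + 2) = Node (enc_nat x) (enc_list enc_nat zs)"
        "\<forall>v. v \<noteq> q + 2 \<longrightarrow> v \<noteq> q + 9 \<longrightarrow> s' v = s v"
      then have "s' 0 = ?D" "s' (q + 7) = enc_nat b" using P by auto
      with h(1) show "eval_expr (star_expr q) s' = enc_edge (star_tuple x)"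
        unfolding enc_star star_expr_def using D tl by simp
    qed (use P D in \<open>auto simp: star_expr_def\<close>)
    from runs_frame[OF this] show ?thesis
      by (rule runs_weaken) (use P fold in \<open>auto simp: writes_map_onto\<close>)
  qed
  have 7: "runs (map_onto (q + 2) (Hd (Tl (Var 0))) (edge_expr q) (q + 9)) s
      ?T7 ?P7"
    if P: "?P6 s" for s
  proof -
    \<comment> \<open>The register already holds the star, and the edges of \<open>H\<close> are
      consed in front of it.\<close>
    have fold: "fold (\<lambda>e. Node (enc_edge (edge_tuple e))) (dks_edges H) (s (q + 9)) =
        enc_list enc_edge (mst_edges I)"
      using P fold_Node_enc_list[of enc_edge edge_tuple "dks_edges H" star_list]
      unfolding mst_edges_I by simp
    have "runs (map_onto (q + 2) (Hd (Tl (Var 0))) (edge_expr q) (q + 9)) s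
      ?T7
      (\<lambda>s'. s' (q + 9) = fold (\<lambda>e. Node (enc_edge (edge_tuple e))) (dks_edges H) (s (q + 9)))"
    proof (rule runs_map_onto[where f = "enc_pair enc_nat enc_nat"])
      show "size (fold (\<lambda>e. Node (enc_edge (edge_tuple e))) (dks_edges H) (s (q + 9))) \<le> M"
        unfolding fold using size_mst_edges M_bounds(4) by linarith
      fix x zs s'
      assume "s' (q + 2) = Node (enc_pair enc_nat enc_nat x) (enc_list (enc_pair enc_nat enc_nat) zs)"
      then show "eval_expr (edge_expr q) s' = enc_edge (edge_tuple x)"
        by (cases x) (simp add: edge_expr_def enc_pair_def)
    qed (use P D sz in \<open>auto simp: edge_expr_def\<close>)
    from runs_frame[OF this] show ?thesis
      by (rule runs_weaken) (use P fold in \<open>auto simp: writes_map_onto\<close>)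
  qed
  let ?e = "Cons (Hd (Var 0)) (Cons (Var (q + 9)) (Cons (Var (q + 7)) (Const (enc_nat 1))))"
  have 8: "runs (Assign 0 ?e) s (expr_cost ?e * Suc M) ?P8" if P: "?P7 s" for s
  proof (rule runs_Assign)
    show "\<forall>v\<in>expr_vars ?e. size (s v) \<le> M"
      using P D sz size_mst_edges M_bounds(4) by auto
    show "?P8 (s(0 := eval_expr ?e s))" using P D by (simp add: enc_mst_I)
  qed
  have P0: "?P0 ((\<lambda>_. Leaf)(0 := ?D) :: store)" by auto
  have cost: "expr_cost (star_expr q) = 57" "expr_weight (star_expr q) = 12"
    "expr_cost (edge_expr q) = 45" "expr_weight (edge_expr q) = 14" "expr_cost ?e = 22"
    by (simp_all add: star_expr_def edge_expr_def enc_rat_0 enc_rat_1 enc_nat_1)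
  \<comment> \<open>220 is the sum of all coefficients, with lower powers of \<open>K\<close> raised
    to the cube.\<close>
  have time: "(2 + 5 + 3) * K ^ 2 + ((3 + 5 + 3) * K ^ 2 + (1 * K + (3 * K + (29 * K ^ 3 +
      ((3 + (57 + 1 + 12 + 1) + 3) * K ^ 2 + ((3 + (45 + 1 + 14 + 1) + 3) * K ^ 2 + 22 * K)))))) \<le> 220 * K ^ 3"
    if "0 < K" for K :: nat
  proof -
    have "K \<le> K ^ 3" "K ^ 2 \<le> K ^ 3"
      using that by (simp_all add: power_increasing self_le_power)
    then show ?thesis by simp
  qed
  have small: "expr_cost (Hd (Var 0)) = 2" "expr_cost (Cons ?h (Var v)) = 5"
    "expr_cost (Hd (Tl (Var 0))) = 3" "expr_cost (Tl (Hd (Var 0))) = 3" "expr_cost (Var v) = 1"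
    "expr_cost (Tl (Tl (Var 0))) = 3"
    "expr_cost (Cons (star_expr q) (Var v)) = 57 + 1 + 12 + 1"
    "expr_cost (Cons (edge_expr q) (Var v)) = 45 + 1 + 14 + 1" for v
    using cost by simp_all
  have "runs (build_mst q) ((\<lambda>_. Leaf)(0 := ?D)) (?T1 + (?T2 + (expr_cost (Var (q + 4)) * Suc M +
      (expr_cost (Tl (Tl (Var 0))) * Suc M + (29 * Suc M ^ 3 + (?T6 + (?T7 + expr_cost ?e * Suc M))))))) ?P8"
    unfolding build_mst_def
    by (rule runs_Seq[OF 1[OF P0] runs_Seq[OF 2 runs_Seq[OF 3 runs_Seq[OF 4
        runs_Seq[OF 5 runs_Seq[OF 6 runs_Seq[OF 7 8]]]]]]])
  then show ?thesis
  proof (rule runs_weaken)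
    show "?T1 + (?T2 + (expr_cost (Var (q + 4)) * Suc M +
      (expr_cost (Tl (Tl (Var 0))) * Suc M + (29 * Suc M ^ 3 + (?T6 + (?T7 + expr_cost ?e * Suc M))))))
      \<le> 220 * Suc M ^ 3"
      unfolding small cost(5) by (rule time) simp
  qed
qed

lemma graph_ends: "i < m \<Longrightarrow> ends i = {fst (rev (dks_edges H) ! i), snd (rev (dks_edges H) ! i)}"
  by (erule graph_edge) (simp add: edge_ends_def)

text \<open>The reversed edge list of \<open>H\<close> is in the order of the positions in
  \<open>mst_edges I\<close>, so edges and bits of the answer can be traversed in parallel.\<close>

lemma runs_extract_nodes:
  assumes s: "s 0 = enc_subset [0..<length (mst_edges I)] R"
    "s (q + 3) = enc_list enc_nat (rev (dks_nodes H))"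
    "s (q + 4) = enc_list (enc_pair enc_nat enc_nat) (rev (dks_edges H))" "s (q + 10) = Leaf"
  shows "runs (extract_nodes q) s (50 * Suc M ^ 3)
    (\<lambda>s'. s' 0 = enc_subset (dks_nodes H) (kept_nodes H R))"
proof -
  let ?bs = "map (\<lambda>i. i \<in> R) [0..<length (mst_edges I)]"
  let ?rn = "enc_list enc_nat (rev (dks_nodes H))"
  let ?P = "\<lambda>s. s (q + 3) = ?rn \<and> (\<exists>ns. s (q + 10) = enc_list enc_nat ns \<and>
    set ns = kept_nodes H R \<and> size (s (q + 10)) \<le> M)"
  let ?Q = "\<lambda>s. ?P s \<and> s 0 = Leaf"
  have sz: "size ?rn \<le> M" "size (enc_list (enc_pair enc_nat enc_nat) (rev (dks_edges H))) \<le> M"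
    using input_sizes(1,2) M_bounds(1) by (simp_all add: size_enc_list_rev)
  have szb: "size (enc_list enc_bool ?bs) \<le> M"
    using size_enc_list_bool[of ?bs] M_bounds(6) length_mst_edges by simp
  \<comment> \<open>Positions are restricted to those of \<open>H\<close>, where the bits are
    defined because \<open>m\<close> is at most the number of all edges.\<close>
  have kept: "(\<Union>i\<in>{i. i < length (rev (dks_edges H)) \<and> \<not> ?bs ! i}.
      {fst (rev (dks_edges H) ! i), snd (rev (dks_edges H) ! i)}) = kept_nodes H R"
    unfolding kept_nodes_def
  proof (rule SUP_cong)
    show "{i. i < length (rev (dks_edges H)) \<and> \<not> ?bs ! i} = {..<m} - R"
      using edge_ids_I(2) by auto
  qed (simp add: graph_ends)
  have "runs (collect_ends (q + 4) 0 (q + 10)) s (19 * Suc M ^ 2)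
    (\<lambda>s'. \<exists>ns. s' (q + 10) = enc_list enc_nat ns \<and>
       set ns = (\<Union>i\<in>{i. i < length (rev (dks_edges H)) \<and> \<not> ?bs ! i}.
         {fst (rev (dks_edges H) ! i), snd (rev (dks_edges H) ! i)}) \<and> size (s' (q + 10)) \<le> M)"
    by (rule runs_collect_ends) (use s sz szb edge_ids_I(2) in \<open>simp_all add: enc_subset_def\<close>)
  from runs_frame[OF this[unfolded kept]]
  have 1: "runs (collect_ends (q + 4) 0 (q + 10)) s (19 * Suc M ^ 2) ?P"
    by (rule runs_weaken) (use s(2) in \<open>auto simp: writes_collect_ends\<close>)
  have 2: "runs (Assign 0 (Const Leaf)) s1 (expr_cost (Const Leaf) * Suc M) ?Q" if "?P s1" for s1
    by (rule runs_Assign) (use that in auto)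
  have 3: "runs (mark_members (q + 3) (q + 10) (q + 11) (q + 12) 0) s2 (20 * Suc M ^ 3)
      (\<lambda>s'. s' 0 = enc_subset (dks_nodes H) (kept_nodes H R))" if Q: "?Q s2" for s2
  proof -
    obtain ns where ns: "s2 (q + 10) = enc_list enc_nat ns" "set ns = kept_nodes H R"
      "size (s2 (q + 10)) \<le> M" using Q by blast
    have "runs (mark_members (q + 3) (q + 10) (q + 11) (q + 12) 0) s2 (20 * Suc M ^ 3)
      (\<lambda>s'. s' 0 = enc_list enc_bool (map (\<lambda>v. v \<in> set ns) (rev (rev (dks_nodes H)))))"
      by (rule runs_mark_members) (use ns Q sz(1) M_bounds(2,6) in auto)
    then show ?thesis by (simp add: ns(2) enc_subset_def)
  qed
  have time: "19 * K ^ 2 + (1 * K + 20 * K ^ 3) \<le> 50 * K ^ 3" if "0 < K" for K :: nat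
  proof -
    have "K \<le> K ^ 3" "K ^ 2 \<le> K ^ 3"
      using that by (simp_all add: power_increasing self_le_power)
    then show ?thesis by simp
  qed
  have cost: "expr_cost (Const Leaf) = 1" by simp
  have "runs (extract_nodes q) s (19 * Suc M ^ 2 + (expr_cost (Const Leaf) * Suc M + 20 * Suc M ^ 3))
      (\<lambda>s'. s' 0 = enc_subset (dks_nodes H) (kept_nodes H R))"
    unfolding extract_nodes_def by (rule runs_Seq[OF 1 runs_Seq[OF 2 3]])
  then show ?thesis
  proof (rule runs_weaken)
    show "19 * Suc M ^ 2 + (expr_cost (Const Leaf) * Suc M + 20 * Suc M ^ 3) \<le> 50 * Suc M ^ 3"
      unfolding cost by (rule time) simp
  qed
qed

end

section \<open>Composition with the interdiction algorithm\<close>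

lemma poly_nat_mono: "x \<le> y \<Longrightarrow> poly p x \<le> poly p y" for p :: "nat poly"
  by (induction p) (auto intro: add_left_mono mult_le_mono)

lemma mst_interdiction_simps:
  "instances mst_interdiction = mst_instances" "feasible mst_interdiction = interdiction_sets"
  "objective mst_interdiction I X = real_of_rat (max_tree_weight I X)"
  "enc_instance mst_interdiction = enc_mst_instance"
  "enc_solution mst_interdiction I X = enc_subset [0..<length (mst_edges I)] X"
  by (simp_all add: mst_interdiction_def)

lemma min_dks_simps:
  "instances min_dks = dks_instances" "feasible min_dks = dks_feasible"
  "objective min_dks H S = real (card S)" "enc_instance min_dks = enc_dks_instance"
  "enc_solution min_dks H S = enc_subset (dks_nodes H) S"
  by (simp_all add: min_dks_def)

theorem theorem6p1:
  fixes \<alpha> :: "nat \<Rightarrow> nat \<Rightarrow> real"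
  assumes "\<exists>A. poly_time_approx mst_interdiction
                 (\<lambda>I. \<alpha> (length (mst_edges I)) (length (mst_nodes I))) A"
  shows "\<exists>A. poly_time_approx min_dks
               (\<lambda>H. 2 * \<alpha> (length (dks_edges H) + length (dks_nodes H) - 1)
                          (length (dks_nodes H))) A"
proof -
  obtain A and p :: "nat poly" where A: "\<And>I. I \<in> mst_instances \<Longrightarrow> \<exists>t. \<exists>X \<in> interdiction_sets I.
      computes_in_time A (enc_mst_instance I) t (enc_subset [0..<length (mst_edges I)] X) \<and>
      t \<le> poly p (size (enc_mst_instance I)) \<and>
      real_of_rat (max_tree_weight I X) \<le>
        \<alpha> (length (mst_edges I)) (length (mst_nodes I)) * optimum mst_interdiction I"
    using assms unfolding poly_time_approx_def mst_interdiction_simps by blast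
  \<comment> \<open>An upper bound for the registers of \<open>A\<close>; inserting 0 makes the
    maximum meaningful also if \<open>A\<close> has no register.\<close>
  define q where "q = Max (insert 0 (com_vars A))"
  have q: "com_vars A \<subseteq> {..q}" using finite_com_vars[of A] by (auto simp: q_def)
  define B where "B = Seq (build_mst q) (Seq A (extract_nodes q))"
  define Mp :: "nat poly" where "Mp = [:30:] * [:1, 1:] ^ 2"
  \<comment> \<open>270 adds up the 220 for building the instance and the 50 for decoding; the
    composition bounds the run of \<open>A\<close> on an instance of size at most
    \<open>M\<close>.\<close>
  define r where "r = [:270:] * (1 + Mp) ^ 3 + pcompose p Mp"
  have "\<exists>t. \<exists>S \<in> dks_feasible H.
      computes_in_time B (enc_dks_instance H) t (enc_subset (dks_nodes H) S) \<and>
      t \<le> poly r (size (enc_dks_instance H)) \<and>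
      real (card S) \<le> 2 * \<alpha> (length (dks_edges H) + length (dks_nodes H) - 1)
        (length (dks_nodes H)) * optimum min_dks H"
    if "H \<in> dks_instances" for H
  proof -
    interpret dks H by standard fact
    obtain t X where X: "X \<in> interdiction_sets I"
      "computes_in_time A (enc_mst_instance I) t (enc_subset [0..<length (mst_edges I)] X)"
      "t \<le> poly p (size (enc_mst_instance I))"
      "real_of_rat (max_tree_weight I X) \<le>
        \<alpha> (length (mst_edges I)) (length (mst_nodes I)) * optimum mst_interdiction I"
      using A[OF dks_to_mst_instance] by blast
    obtain sA where sA: "exec A ((\<lambda>_. Leaf)(0 := enc_mst_instance I)) t sA"
      "sA 0 = enc_subset [0..<length (mst_edges I)] X"
      using X(2) unfolding computes_in_time_def by blast
    let ?s0 = "(\<lambda>_. Leaf)(0 := enc_dks_instance H) :: store"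
    obtain t1 s1 where s1: "exec (build_mst q) ?s0 t1 s1" "t1 \<le> 220 * Suc M ^ 3"
      "\<forall>v. v \<notin> writes (build_mst q) \<longrightarrow> s1 v = ?s0 v" "s1 0 = enc_mst_instance I"
      "s1 (q + 3) = enc_list enc_nat (rev (dks_nodes H))"
      "s1 (q + 4) = enc_list (enc_pair enc_nat enc_nat) (rev (dks_edges H))"
      using runs_build_mst[of q] unfolding runs_def by blast
    \<comment> \<open>The registers up to \<open>q\<close> have to be clean for \<open>A\<close>,
      and \<open>q + 10\<close> for \<open>extract_nodes\<close>.\<close>
    have Leaf: "s1 v = Leaf" if "v \<noteq> 0" "v < q + 2 \<or> q + 9 < v" for v
    proof -
      have "v \<notin> {0} \<union> {q + 2..q + 9}" using that by auto
      then have "v \<notin> writes (build_mst q)" using writes_build_mst by blast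
      then show ?thesis using s1(3) that(1) by simp
    qed
    \<comment> \<open>As far as \<open>A\<close> can see, the store is its specified initial one, so
      its run transfers with the same time and the same output.\<close>
    have "\<forall>x\<in>{..q}. ((\<lambda>_. Leaf)(0 := enc_mst_instance I)) x = s1 x"
      using Leaf s1(4) by simp
    from exec_agree[OF sA(1) q this] obtain s2 where
      s2: "exec A s1 t s2" "\<forall>x\<in>{..q}. sA x = s2 x" by blast
    have frame: "s2 v = s1 v" if "q < v" for v
      using exec_frame[OF s2(1)] writes_subset_com_vars[of A] q that
      by (meson atMost_iff leD subsetD)
    have "runs (extract_nodes q) s2 (50 * Suc M ^ 3)
        (\<lambda>s'. s' 0 = enc_subset (dks_nodes H) (kept_nodes H X))"
      by (rule runs_extract_nodes) (use s2(2) sA(2) frame s1 Leaf in auto)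
    then obtain t3 s3 where s3: "exec (extract_nodes q) s2 t3 s3" "t3 \<le> 50 * Suc M ^ 3"
      "s3 0 = enc_subset (dks_nodes H) (kept_nodes H X)" unfolding runs_def by blast
    have "exec B ?s0 (t1 + (t + t3)) s3"
      unfolding B_def by (intro exec.Seq) (fact s1(1) s2(1) s3(1))+
    with s3(3) have "computes_in_time B (enc_dks_instance H) (t1 + (t + t3))
        (enc_subset (dks_nodes H) (kept_nodes H X))"
      unfolding computes_in_time_def by blast
    moreover have "t1 + (t + t3) \<le> poly r (size (enc_dks_instance H))"
    proof -
      have Mp: "poly Mp (size (enc_dks_instance H)) = M" by (simp add: Mp_def M_def)
      have "t \<le> poly p M" using X(3) poly_nat_mono[OF M_bounds(5)] order_trans by blast
      moreover have "poly r (size (enc_dks_instance H)) = 270 * Suc M ^ 3 + poly p M"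
        by (simp add: r_def poly_pcompose Mp)
      ultimately show ?thesis using s1(2) s3(2) by linarith
    qed
    moreover have "real (card (kept_nodes H X)) \<le> 2 * \<alpha> (length (dks_edges H) + length (dks_nodes H) - 1)
        (length (dks_nodes H)) * optimum min_dks H"
      using kept_nodes_approx[OF X(1)] X(4) by (simp add: length_mst_edges mst_nodes_I)
    ultimately show ?thesis using kept_nodes_feasible[OF X(1)] by blast
  qed
  then have "poly_time_approx min_dks (\<lambda>H. 2 * \<alpha> (length (dks_edges H) + length (dks_nodes H) - 1)
      (length (dks_nodes H))) B"
    unfolding poly_time_approx_def min_dks_simps by blast
  then show ?thesis by blast
qed

end
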